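(* Let $(\mathfrak{A},\varphi,T)$ be a strictly weak mixing state preserving $C^*$-dynamical system. Then for every $x\in\mathfrak{A}$ and every $S$-Besicovitch sequence $\{b_n\}_{n\ge 0}\subset\mathbb{C}$, the averages $$\frac{1}{n}\sum_{k=0}^{n-1}b_kT^{k}(x)$$ converge in the norm of $\mathfrak{A}$ as $n\to\infty$.
   Context: All $C^*$-algebras are unital, with unit denoted $\mathbf{1}$; $\mathfrak{A}^*$ is the Banach space dual of $\mathfrak{A}$. A ucp map is a completely positive linear map $T:\mathfrak{A}\to\mathfrak{A}$ with $T\mathbf{1}=\mathbf{1}$. A state preserving $C^*$-dynamical system is a triple $(\mathfrak{A},\varphi,T)$ consisting of a unital $C^*$-algebra $\mathfrak{A}$, a state $\varphi$ on $\mathfrak{A}$ and a ucp map $T$ on $\mathfrak{A}$ with $\varphi\circ T=\varphi$. It is called: - uniquely ergodic (with respect to $\varphi$) if $\varphi$ is the only state on $\mathfrak{A}$ invariant under $T$; - strictly weak mixing (with respect to $\varphi$) if $\lim_{n\to\infty}\frac1n\sum_{k=0}^{n-1}|\psi(T^k(x))-\psi(\mathbf{1})\varphi(x)|=0$ for all $x\in\mathfrak{A}$ and $\psi\in\mathfrak{A}^*$. A bounded sequence $\{b_n\}_{n\ge0}\subset\mathbb{C}$ is called $S$-Besicovitch if for every $\epsilon>0$ there exist a uniquely ergodic state preserving $C^*$-dynamical system $(C(K),\nu,T_1)$, where $C(K)$ is the $C^*$-algebra of continuous complex functions on a compact Hausdorff space $K$, a function $f_0\in C(K)$ and a point $\omega_0\in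 K$ such that $$\limsup_{n\to\infty}\frac{1}{n}\sum_{k=0}^{n-1}\big|b_k-(T_1^kf_0)(\omega_0)\big|<\epsilon.$$ *)

theory Defs
  imports
    "HOL-Analysis.Analysis"
    "HOL-Library.Nonpos_Ints"
    "HOL-Algebra.Algebraic_Closure_Type"
begin

section \<open>Unital $C^*$-algebras\<close>

text \<open>
  Algebras are carrier-based, extending the module records of HOL-Algebra, because $C(K)$ for a
  topology \<open>K\<close> that varies inside a formula cannot be a type.
\<close>

record 'a cstar = "(complex, 'a) module" +
  star :: "'a \<Rightarrow> 'a"
  cnorm :: "'a \<Rightarrow> real"

locale cstar_algebra =
  ring A + Module.module "ring_of_type_algebra :: complex ring" A
  for A :: "'a cstar" (structure) +
  assumes smult_mult_left:
      "\<lbrakk>x \<in> carrier A; y \<in> carrier A\<rbrakk> \<Longrightarrow> (c \<odot> x) \<otimes> y = c \<odot> (x \<otimes> y)"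
    and smult_mult_right:
      "\<lbrakk>x \<in> carrier A; y \<in> carrier A\<rbrakk> \<Longrightarrow> x \<otimes> (c \<odot> y) = c \<odot> (x \<otimes> y)"
    and star_closed: "x \<in> carrier A \<Longrightarrow> star A x \<in> carrier A"
    and star_star: "x \<in> carrier A \<Longrightarrow> star A (star A x) = x"
    and star_add:
      "\<lbrakk>x \<in> carrier A; y \<in> carrier A\<rbrakk> \<Longrightarrow> star A (x \<oplus> y) = star A x \<oplus> star A y"
    and star_smult: "x \<in> carrier A \<Longrightarrow> star A (c \<odot> x) = cnj c \<odot> star A x"
    and star_mult:
      "\<lbrakk>x \<in> carrier A; y \<in> carrier A\<rbrakk> \<Longrightarrow> star A (x \<otimes> y) = star A y \<otimes> star A x"
    and norm_nonneg: "x \<in> carrier A \<Longrightarrow> 0 \<le> cnorm A x"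
    and norm_eq_zero_iff: "x \<in> carrier A \<Longrightarrow> cnorm A x = 0 \<longleftrightarrow> x = \<zero>"
    and norm_add:
      "\<lbrakk>x \<in> carrier A; y \<in> carrier A\<rbrakk> \<Longrightarrow> cnorm A (x \<oplus> y) \<le> cnorm A x + cnorm A y"
    and norm_smult: "x \<in> carrier A \<Longrightarrow> cnorm A (c \<odot> x) = cmod c * cnorm A x"
    and norm_mult:
      "\<lbrakk>x \<in> carrier A; y \<in> carrier A\<rbrakk> \<Longrightarrow> cnorm A (x \<otimes> y) \<le> cnorm A x * cnorm A y"
    and cstar_identity: "x \<in> carrier A \<Longrightarrow> cnorm A (star A x \<otimes> x) = (cnorm A x)\<^sup>2"
    and norm_complete: 
      "\<lbrakk>\<And>n. s n \<in> carrier A;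
        \<And>\<epsilon>. 0 < \<epsilon> \<Longrightarrow> \<exists>N. \<forall>m\<ge>N. \<forall>n\<ge>N. cnorm A (s m \<ominus> s n) < \<epsilon>\<rbrakk>
       \<Longrightarrow> \<exists>y\<in>carrier A. (\<lambda>n. cnorm A (s n \<ominus> y)) \<longlonglongrightarrow> 0"


section \<open>Functionals, states and completely positive maps\<close>

text \<open>
  Maps on an algebra are functions on the ambient type, and only their restriction to the carrier
  matters; in particular equality of functionals means equality on the carrier.
\<close>

definition linear_functional :: "'a cstar \<Rightarrow> ('a \<Rightarrow> complex) \<Rightarrow> bool"
  where "linear_functional A \<psi> \<longleftrightarrow>
    (\<forall>x\<in>carrier A. \<forall>y\<in>carrier A. \<psi> (x \<oplus>\<^bsub>A\<^esub> y) = \<psi> x + \<psi> y) \<and>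
    (\<forall>c. \<forall>x\<in>carrier A. \<psi> (c \<odot>\<^bsub>A\<^esub> x) = c * \<psi> x)"

definition in_dual :: "'a cstar \<Rightarrow> ('a \<Rightarrow> complex) \<Rightarrow> bool"
  where "in_dual A \<psi> \<longleftrightarrow> linear_functional A \<psi> \<and>
    (\<exists>C. \<forall>x\<in>carrier A. cmod (\<psi> x) \<le> C * cnorm A x)"

definition state :: "'a cstar \<Rightarrow> ('a \<Rightarrow> complex) \<Rightarrow> bool"
  where "state A \<phi> \<longleftrightarrow> linear_functional A \<phi> \<and>
    (\<forall>x\<in>carrier A. \<phi> (star A x \<otimes>\<^bsub>A\<^esub> x) \<in> \<real>\<^sub>\<ge>\<^sub>0) \<and>
    \<phi> \<one>\<^bsub>A\<^esub> = 1"

definition linear_map :: "'a cstar \<Rightarrow> ('a \<Rightarrow> 'a) \<Rightarrow> bool"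
  where "linear_map A T \<longleftrightarrow> T \<in> carrier A \<rightarrow> carrier A \<and>
    (\<forall>x\<in>carrier A. \<forall>y\<in>carrier A. T (x \<oplus>\<^bsub>A\<^esub> y) = T x \<oplus>\<^bsub>A\<^esub> T y) \<and>
    (\<forall>c. \<forall>x\<in>carrier A. T (c \<odot>\<^bsub>A\<^esub> x) = c \<odot>\<^bsub>A\<^esub> T x)"

text \<open>
  Matrices in $M_n(A)$ are functions of two indices, read only at indices below \<open>n\<close>. A matrix is
  positive if it is of the form $N^*N$ with $N \in M_n(A)$.
\<close>

definition positive_matrix :: "'a cstar \<Rightarrow> nat \<Rightarrow> (nat \<Rightarrow> nat \<Rightarrow> 'a) \<Rightarrow> bool"
  where "positive_matrix A n M \<longleftrightarrow>
    (\<exists>N. (\<forall>i<n. \<forall>j<n. N i j \<in> carrier A) \<and>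
      (\<forall>i<n. \<forall>j<n. M i j = (\<Oplus>\<^bsub>A\<^esub>k\<in>{..<n}. star A (N k i) \<otimes>\<^bsub>A\<^esub> N k j)))"

definition completely_positive :: "'a cstar \<Rightarrow> ('a \<Rightarrow> 'a) \<Rightarrow> bool"
  where "completely_positive A T \<longleftrightarrow> linear_map A T \<and>
    (\<forall>n M. positive_matrix A n M \<longrightarrow> positive_matrix A n (\<lambda>i j. T (M i j)))"

definition ucp :: "'a cstar \<Rightarrow> ('a \<Rightarrow> 'a) \<Rightarrow> bool"
  where "ucp A T \<longleftrightarrow> completely_positive A T \<and> T \<one>\<^bsub>A\<^esub> = \<one>\<^bsub>A\<^esub>"


section \<open>State preserving $C^*$-dynamical systems\<close>

definition state_preserving_system :: "'a cstar \<Rightarrow> ('a \<Rightarrow> complex) \<Rightarrow> ('a \<Rightarrow> 'a) \<Rightarrow> bool"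
  where "state_preserving_system A \<phi> T \<longleftrightarrow>
    cstar_algebra A \<and> state A \<phi> \<and> ucp A T \<and> (\<forall>x\<in>carrier A. \<phi> (T x) = \<phi> x)"

definition uniquely_ergodic :: "'a cstar \<Rightarrow> ('a \<Rightarrow> complex) \<Rightarrow> ('a \<Rightarrow> 'a) \<Rightarrow> bool"
  where "uniquely_ergodic A \<phi> T \<longleftrightarrow> state_preserving_system A \<phi> T \<and>
    (\<forall>\<psi>. state A \<psi> \<and> (\<forall>x\<in>carrier A. \<psi> (T x) = \<psi> x) \<longrightarrow> (\<forall>x\<in>carrier A. \<psi> x = \<phi> x))"

definition strictly_weak_mixing :: "'a cstar \<Rightarrow> ('a \<Rightarrow> complex) \<Rightarrow> ('a \<Rightarrow> 'a) \<Rightarrow> bool"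
  where "strictly_weak_mixing A \<phi> T \<longleftrightarrow> state_preserving_system A \<phi> T \<and>
    (\<forall>x\<in>carrier A. \<forall>\<psi>. in_dual A \<psi> \<longrightarrow>
      (\<lambda>n. 1 / real n * (\<Sum>k<n. cmod (\<psi> ((T ^^ k) x) - \<psi> \<one>\<^bsub>A\<^esub> * \<phi> x))) \<longlonglongrightarrow> 0)"


section \<open>The algebra of continuous functions and Besicovitch sequences\<close>

text \<open>Elements of $C(K)$ are extensional outside the space; the \<open>insert 0\<close> only matters for the
  empty space.\<close>

definition cont_algebra :: "'k topology \<Rightarrow> ('k \<Rightarrow> complex) cstar"
  where "cont_algebra K =
    \<lparr>carrier = {f \<in> extensional (topspace K). continuous_map K euclidean f},
     monoid.mult = (\<lambda>f g. \<lambda>\<omega>\<in>topspace K. f \<omega> * g \<omega>),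
     one = (\<lambda>\<omega>\<in>topspace K. 1),
     ring.zero = (\<lambda>\<omega>\<in>topspace K. 0),
     add = (\<lambda>f g. \<lambda>\<omega>\<in>topspace K. f \<omega> + g \<omega>),
     smult = (\<lambda>c f. \<lambda>\<omega>\<in>topspace K. c * f \<omega>),
     star = (\<lambda>f. \<lambda>\<omega>\<in>topspace K. cnj (f \<omega>)),
     cnorm = (\<lambda>f. Sup (insert 0 ((\<lambda>\<omega>. cmod (f \<omega>)) ` topspace K)))\<rparr>"

lemma cstar_algebra_cont_algebra:
  assumes "compact_space K"
  shows "cstar_algebra (cont_algebra K)"
proof -
  let ?A = "cont_algebra K" and ?S = "topspace K"
  let ?C = "cfunspace K (euclidean_metric :: complex metric)"
  note defs = cont_algebra_def ring_of_type_algebra_def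
  have bdd: "bdd_above (insert 0 ((\<lambda>\<omega>. cmod (f \<omega>)) ` ?S))" if "f \<in> carrier ?A" for f
  proof -
    have "compactin euclidean (f ` ?S)"
      by (rule image_compactin[of K]) (use that assms in \<open>auto simp: defs compact_space_def\<close>)
    then have "bounded (f ` ?S)"
      by (simp add: compact_imp_bounded)
    then show ?thesis
      by (auto simp: bounded_iff bdd_above_def intro: max.coboundedI1 max.coboundedI2)
  qed
  have ub: "cmod (f \<omega>) \<le> cnorm ?A f" if "f \<in> carrier ?A" "\<omega> \<in> ?S" for f \<omega>
    using bdd[OF that(1)] that(2) by (auto simp: defs intro!: cSup_upper)
  have nn: "0 \<le> cnorm ?A f" if "f \<in> carrier ?A" for f
    using bdd[OF that] by (auto simp: defs intro!: cSup_upper)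
  have lub: "cnorm ?A f \<le> B" if "0 \<le> B" "\<And>\<omega>. \<omega> \<in> ?S \<Longrightarrow> cmod (f \<omega>) \<le> B" for f B
    using that by (auto simp: defs intro!: cSup_least)
  have cont: "continuous_map K euclidean (\<lambda>\<omega>\<in>?S. g \<omega>) \<longleftrightarrow> continuous_map K euclidean g"
    for g :: "'a \<Rightarrow> complex"
    by (auto elim: continuous_map_eq)
  have mult_cont: "continuous_map K euclidean (\<lambda>\<omega>. f \<omega> * g \<omega>)"
    if "continuous_map K euclidean f" "continuous_map K euclidean g" for f g :: "'a \<Rightarrow> complex"
    using that by (simp add: continuous_map_atin tendsto_mult)
  have cnj_cont: "continuous_map K euclidean (\<lambda>\<omega>. cnj (f \<omega>))"
    if "continuous_map K euclidean f" for f
    using continuous_map_compose[OF that, of euclidean cnj]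
    by (simp add: o_def continuous_on_cnj)
  have inv: "\<exists>g\<in>carrier ?A. g \<oplus>\<^bsub>?A\<^esub> f = \<zero>\<^bsub>?A\<^esub>" if "f \<in> carrier ?A" for f
    using that by (intro bexI[of _ "\<lambda>\<omega>\<in>?S. - f \<omega>"])
      (auto simp: defs cont intro: restrict_ext continuous_map_minus)
  have grp: "abelian_group ?A"
    using inv
    by (intro abelian_groupI)
      (auto simp: defs cont algebra_simps fun_eq_iff extensional_def intro: continuous_map_add)
  have mon: "Group.monoid ?A"
    by (intro monoidI)
      (auto simp: defs cont algebra_simps fun_eq_iff extensional_def
        intro: mult_cont)
  have rng: "Ring.ring ?A"
    by (intro ringI grp mon) (auto simp: defs algebra_simps fun_eq_iff)
  have mdl: "Module.module (ring_of_type_algebra :: complex ring) ?A"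
    by (intro Module.moduleI grp cring_from_type_algebra)
      (auto simp: defs cont algebra_simps fun_eq_iff extensional_def
        intro: mult_cont)
  interpret R: Ring.ring ?A by (rule rng)
  have minus: "(f \<ominus>\<^bsub>?A\<^esub> g) \<omega> = f \<omega> - g \<omega>"
    if "f \<in> carrier ?A" "g \<in> carrier ?A" "\<omega> \<in> ?S" for f g \<omega>
  proof -
    have "f \<omega> = ((f \<ominus>\<^bsub>?A\<^esub> g) \<oplus>\<^bsub>?A\<^esub> g) \<omega>"
      using that by (simp add: R.minus_eq R.a_assoc R.l_neg)
    also have "\<dots> = (f \<ominus>\<^bsub>?A\<^esub> g) \<omega> + g \<omega>"
      using that(3) by (simp add: cont_algebra_def[of K] )
    finally show ?thesis by simp
  qed
  have carr: "carrier ?A = mspace ?C"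
    using assms by (subst compactin_mspace_cfunspace) (auto simp: defs compact_space_def)
  have dist: "cnorm ?A (f \<ominus>\<^bsub>?A\<^esub> g) = mdist ?C f g" if f: "f \<in> carrier ?A" and g: "g \<in> carrier ?A" for f g
  proof (rule antisym)
    have fg: "f \<ominus>\<^bsub>?A\<^esub> g \<in> carrier ?A"
      using f g by simp
    have "dist (f \<omega>) (g \<omega>) \<le> mdist ?C f g" if "\<omega> \<in> ?S" for \<omega>
      using mdist_cfunspace_imp_mdist_le[of f K "euclidean_metric :: complex metric" g _ \<omega>]
        f g that by (simp add: carr)
    then show "cnorm ?A (f \<ominus>\<^bsub>?A\<^esub> g) \<le> mdist ?C f g"
      by (intro lub) (auto simp: minus f g dist_norm)
    have "dist (f \<omega>) (g \<omega>) \<le> cnorm ?A (f \<ominus>\<^bsub>?A\<^esub> g)" if "\<omega> \<in> ?S" for \<omega>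
      using ub[OF fg that] minus[OF f g that] by (simp add: dist_norm)
    then show "mdist ?C f g \<le> cnorm ?A (f \<ominus>\<^bsub>?A\<^esub> g)"
      using nn[OF fg] by (intro mdist_cfunspace_le) auto
  qed
  have complete: "\<exists>l\<in>carrier ?A. (\<lambda>n. cnorm ?A (s n \<ominus>\<^bsub>?A\<^esub> l)) \<longlonglongrightarrow> 0"
    if s: "\<And>n. s n \<in> carrier ?A"
      and cauchy: "\<And>\<epsilon>. 0 < \<epsilon> \<Longrightarrow> \<exists>N. \<forall>m\<ge>N. \<forall>n\<ge>N. cnorm ?A (s m \<ominus>\<^bsub>?A\<^esub> s n) < \<epsilon>" for s
  proof -
    interpret C: Metric_space "carrier ?A" "mdist ?C"
      unfolding carr by (rule Metric_space_mspace_mdist)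
    have "C.mcomplete"
      using Met_TC.mcomplete_cfunspace[where ?'a = complex, of K] complete_UNIV
      by (simp add: carr mcomplete_of_def Met_TC.Self_def euclidean_metric_def
          flip: mcomplete_iff_complete)
    moreover have "C.MCauchy s"
      using s cauchy by (auto simp: C.MCauchy_def dist)
    ultimately obtain l where l: "limitin C.mtopology s l sequentially"
      unfolding C.mcomplete_def by blast
    then have "l \<in> carrier ?A" and "(\<lambda>n. mdist ?C (s n) l) \<longlonglongrightarrow> 0"
      by (auto simp: C.limitin_metric_dist_null)
    then show ?thesis
      using s by (auto simp: dist)
  qed
  have submult: "cnorm ?A (f \<otimes>\<^bsub>?A\<^esub> g) \<le> cnorm ?A f * cnorm ?A g"
    if f: "f \<in> carrier ?A" and g: "g \<in> carrier ?A" for f g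
    using nn[OF f] nn[OF g] ub[OF f] ub[OF g]
    by (intro lub) (auto simp: cont_algebra_def[of K] norm_mult intro!: mult_mono)
  show ?thesis
  proof (intro cstar_algebra.intro rng mdl cstar_algebra_axioms.intro)
    fix f assume f: "f \<in> carrier ?A"
    show "star ?A f \<in> carrier ?A"
      using f by (auto simp: defs cont cnj_cont)
    show "star ?A (star ?A f) = f"
      using f by (auto simp: defs fun_eq_iff extensional_def)
    show "0 \<le> cnorm ?A f"
      by (rule nn[OF f])
    show "cnorm ?A f = 0 \<longleftrightarrow> f = \<zero>\<^bsub>?A\<^esub>"
    proof
      assume "cnorm ?A f = 0"
      then show "f = \<zero>\<^bsub>?A\<^esub>"
        using ub[OF f] f by (auto simp: cont_algebra_def[of K] fun_eq_iff extensional_def)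
    next
      assume "f = \<zero>\<^bsub>?A\<^esub>"
      then show "cnorm ?A f = 0"
        using nn[OF f] by (intro antisym lub) (auto simp: cont_algebra_def)
    qed
    show scale: "cnorm ?A (c \<odot>\<^bsub>?A\<^esub> f) = cmod c * cnorm ?A f" for c
    proof (rule antisym)
      show "cnorm ?A (c \<odot>\<^bsub>?A\<^esub> f) \<le> cmod c * cnorm ?A f"
        using nn[OF f] ub[OF f]
        by (intro lub) (auto simp: cont_algebra_def[of K] norm_mult intro!: mult_left_mono)
      have cf: "c \<odot>\<^bsub>?A\<^esub> f \<in> carrier ?A"
        using f by (auto simp: defs cont intro: mult_cont)
      show "cmod c * cnorm ?A f \<le> cnorm ?A (c \<odot>\<^bsub>?A\<^esub> f)"
      proof (cases "c = 0")
        case False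
        have "cnorm ?A f \<le> cnorm ?A (c \<odot>\<^bsub>?A\<^esub> f) / cmod c"
        proof (rule lub)
          show "0 \<le> cnorm ?A (c \<odot>\<^bsub>?A\<^esub> f) / cmod c"
            using nn[OF cf] by simp
          fix \<omega> assume "\<omega> \<in> ?S"
          moreover from this have "(c \<odot>\<^bsub>?A\<^esub> f) \<omega> = c * f \<omega>"
            by (simp add: cont_algebra_def)
          ultimately show "cmod (f \<omega>) \<le> cnorm ?A (c \<odot>\<^bsub>?A\<^esub> f) / cmod c"
            using ub[OF cf, of \<omega>] False by (simp add: norm_mult field_simps)
        qed
        then show ?thesis
          using False by (simp add: field_simps)
      qed (use nn[OF cf] in simp)
    qed
    have sf: "star ?A f \<otimes>\<^bsub>?A\<^esub> f \<in> carrier ?A"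
      using f \<open>star ?A f \<in> carrier ?A\<close> by simp
    show "cnorm ?A (star ?A f \<otimes>\<^bsub>?A\<^esub> f) = (cnorm ?A f)\<^sup>2"
    proof (rule antisym)
      have val: "cmod ((star ?A f \<otimes>\<^bsub>?A\<^esub> f) \<omega>) = (cmod (f \<omega>))\<^sup>2" if "\<omega> \<in> ?S" for \<omega>
        using that by (simp add: cont_algebra_def norm_mult power2_eq_square)
      show "cnorm ?A (star ?A f \<otimes>\<^bsub>?A\<^esub> f) \<le> (cnorm ?A f)\<^sup>2"
        using ub[OF f] by (intro lub) (auto simp: val intro!: power_mono)
      have "cnorm ?A f \<le> sqrt (cnorm ?A (star ?A f \<otimes>\<^bsub>?A\<^esub> f))"
        using nn[OF sf] ub[OF sf] val by (intro lub) (auto intro!: real_le_rsqrt)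
      then show "(cnorm ?A f)\<^sup>2 \<le> cnorm ?A (star ?A f \<otimes>\<^bsub>?A\<^esub> f)"
        using nn[OF f] nn[OF sf] sqrt_ge_absD by fastforce
    qed
  next
    fix f g assume f: "f \<in> carrier ?A" and g: "g \<in> carrier ?A"
    show "cnorm ?A (f \<oplus>\<^bsub>?A\<^esub> g) \<le> cnorm ?A f + cnorm ?A g"
      using nn[OF f] nn[OF g] ub[OF f] ub[OF g]
      by (intro lub) (auto simp: cont_algebra_def[of K] intro!: norm_triangle_le add_mono)
  qed (use complete submult in \<open>auto simp: defs algebra_simps fun_eq_iff\<close>)
qed

text \<open>
  The compact spaces range over all topologies whose points are of type \<open>'k\<close>. A theorem with \<open>'k\<close>
  as a free type variable covers all $S$-Besicovitch sequences: countably many values of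
  \<open>\<epsilon>\<close> suffice, and countably many spaces embed into one type, e.g. their disjoint union.
\<close>

definition S_Besicovitch :: "'k itself \<Rightarrow> (nat \<Rightarrow> complex) \<Rightarrow> bool"
  where "S_Besicovitch t b \<longleftrightarrow> bounded (range b) \<and>
    (\<forall>\<epsilon>>0. \<exists>(K :: 'k topology) \<nu> T\<^sub>1 f\<^sub>0 \<omega>\<^sub>0.
      compact_space K \<and> Hausdorff_space K \<and>
      uniquely_ergodic (cont_algebra K) \<nu> T\<^sub>1 \<and>
      f\<^sub>0 \<in> carrier (cont_algebra K) \<and> \<omega>\<^sub>0 \<in> topspace K \<and>
      limsup (\<lambda>n. ereal (1 / real n * (\<Sum>k<n. cmod (b k - (T\<^sub>1 ^^ k) f\<^sub>0 \<omega>\<^sub>0)))) < ereal \<epsilon>)"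

definition weighted_average ::
    "'a cstar \<Rightarrow> (nat \<Rightarrow> complex) \<Rightarrow> ('a \<Rightarrow> 'a) \<Rightarrow> 'a \<Rightarrow> nat \<Rightarrow> 'a"
  where "weighted_average A b T x n =
    (1 / of_nat n) \<odot>\<^bsub>A\<^esub> (\<Oplus>\<^bsub>A\<^esub>k\<in>{..<n}. b k \<odot>\<^bsub>A\<^esub> (T ^^ k) x)"

end

theory Submission
  imports Defs
begin

text \<open>
  Subtracting \<open>\<phi>(x) 1\<close> from \<open>x\<close> splits the weighted average into a multiple of the average of \<open>b\<close>
  and the weighted average of an element \<open>z\<close> with \<open>\<psi>(T\<^sup>k z) \<rightarrow> 0\<close> in Cesaro mean of absolute values for
  every \<open>\<psi>\<close> in the dual. On a weak* compact set of functionals that is invariant under \<open>\<psi> \<mapsto> \<psi> \<circ> T\<close>, such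
  pointwise convergence of nonnegative orbit averages is automatically uniform, and since functionals
  detect the norm, the second part tends to 0 in norm for every bounded \<open>b\<close>. The averages of \<open>b\<close> converge
  because orbit averages in a uniquely ergodic system do. Power boundedness of \<open>T\<close> comes from positivity
  alone: \<open>a* a + b* b = c 1\<close> bounds the norm of \<open>a* a\<close>, once elements \<open>a* a\<close> are known to have
  self-adjoint square roots.
\<close>

section \<open>Compactness and Cesaro averages\<close>

text \<open>Strict weak mixing bounds sums of absolute values, so a bounded weight can be pulled out
  of the sum; \<open>b\<close> then acts only through its mean \<open>\<beta>\<close>, and the limit
  is \<open>\<phi> x * \<beta>\<close> times the unit. The obstacle is that the hypothesis treats
  one functional at a time. Uniformity needs a compact set of functionals that composition with
  \<open>T\<close> maps into itself and that still contains norming functionals. With the crude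
  bound 6 for the powers of \<open>T\<close>, a norm ball is not known to be mapped into itself, so
  the set also records a bound along the whole orbit. Any bound independent of the power will do: 2
  comes from complexifying a real functional, 6 from a positive unital map, and 12 is their product.
  That bound has to be reached without spectra. A self-adjoint \<open>h\<close> counts as positive
  if \<open>|t 1 - h| <= t\<close> for some \<open>t >= 0\<close>, a condition on the norm that
  suits sums and an iteration for square roots. That elements \<open>a* a\<close> satisfy it is the
  hard step, because maps are positive in terms of such elements.\<close>

lemma compact_box:
  fixes r :: "'b \<Rightarrow> real"
  shows "compact {f :: 'b \<Rightarrow> complex. \<forall>x. cmod (f x) \<le> r x}"
proof -
  \<comment> \<open>The box is a product of closed discs, so Tychonoff applies. The topology on
    functions is pointwise convergence and serves as the weak* topology.\<close>
  have "{f :: 'b \<Rightarrow> complex. \<forall>x. cmod (f x) \<le> r x} = (\<Pi>\<^sub>E x\<in>UNIV. cball 0 (r x))"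
    by (auto simp: PiE_UNIV_domain)
  moreover have "compactin (product_topology (\<lambda>_. euclidean) UNIV) (\<Pi>\<^sub>E x\<in>(UNIV :: 'b set). cball (0::complex) (r x))"
    by (subst compactin_PiE) auto
  ultimately show ?thesis by (simp add: euclidean_product_topology)
qed

text \<open>Filters stand in for subsequences: a product of discs is compact but in general not
  sequentially compact, so a cluster point is reached only along a finer filter.\<close>

lemma cluster_filter_compact:
  fixes f :: "'b \<Rightarrow> 'c :: topological_space"
  assumes "compact K" "F \<noteq> bot" "eventually (\<lambda>n. f n \<in> K) F"
  obtains l G where "l \<in> K" "G \<le> F" "G \<noteq> bot" "(f \<longlongrightarrow> l) G"
proof -
  obtain l where l: "l \<in> K" "inf (nhds l) (filtermap f F) \<noteq> bot"
    using compact_filter[THEN iffD1, OF assms(1), rule_format, of "filtermap f F"] assms(2,3)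
    by (auto simp: eventually_filtermap filtermap_bot_iff)
  \<comment> \<open>The largest filter below \<open>F\<close> along which \<open>f\<close> tends to
    \<open>l\<close>; it is proper because \<open>l\<close> is a cluster point.\<close>
  let ?G = "inf F (filtercomap f (nhds l))"
  have "?G \<noteq> bot"
  proof
    assume "?G = bot"
    then have "eventually (\<lambda>_. False) ?G" by simp
    then obtain P R where P: "eventually P F" and R: "eventually R (nhds l)" and PR: "\<And>x. P x \<Longrightarrow> \<not> R (f x)"
      unfolding eventually_inf eventually_filtercomap by blast
    have "eventually (\<lambda>y. \<not> R y) (filtermap f F)"
      unfolding eventually_filtermap by (rule eventually_mono[OF P PR])
    with R have "eventually (\<lambda>_. False) (inf (nhds l) (filtermap f F))"
      unfolding eventually_inf by blast
    then show False using l(2) by (simp add: trivial_limit_def)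
  qed
  moreover have "(f \<longlongrightarrow> l) ?G"
    unfolding filterlim_iff_le_filtercomap by simp
  ultimately show thesis using that[of l ?G] l(1) by simp
qed

text \<open>By compactness some averages up to a uniform time are small at every point; cutting each
  orbit greedily into such pieces bounds all later averages.\<close>

lemma cesaro_null_uniform:
  fixes g :: "'b :: topological_space \<Rightarrow> nat \<Rightarrow> real"
  assumes B: "compact B" and cont: "\<And>k. continuous_on B (\<lambda>\<psi>. g \<psi> k)"
    and shift: "\<And>\<psi>. \<psi> \<in> B \<Longrightarrow> \<exists>\<psi>'\<in>B. \<forall>k. g \<psi>' k = g \<psi> (Suc k)"
    and bd: "\<And>\<psi> k. \<psi> \<in> B \<Longrightarrow> g \<psi> k \<le> M" and M: "0 \<le> M"
    and lim: "\<And>\<psi>. \<psi> \<in> B \<Longrightarrow> (\<lambda>n. 1 / real n * (\<Sum>k<n. g \<psi> k)) \<longlonglongrightarrow> 0"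
    and \<epsilon>: "0 < \<epsilon>"
  shows "\<exists>N. \<forall>n\<ge>N. \<forall>\<psi>\<in>B. 1 / real n * (\<Sum>k<n. g \<psi> k) \<le> \<epsilon>"
proof -
  define S where "S \<psi> n = (\<Sum>k<n. g \<psi> k)" for \<psi> n
  have "\<exists>V. open V \<and> V \<inter> B = (\<lambda>\<psi>. S \<psi> n) -` {..<\<epsilon> / 2 * real n} \<inter> B" for n
  proof -
    have "continuous_on B (\<lambda>\<psi>. S \<psi> n)" unfolding S_def by (intro continuous_on_sum cont)
    then show ?thesis unfolding continuous_on_open_invariant by (meson open_lessThan)
  qed
  then have "\<exists>V. \<forall>n. open (V n) \<and> V n \<inter> B = (\<lambda>\<psi>. S \<psi> n) -` {..<\<epsilon> / 2 * real n} \<inter> B"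
    by (intro choice allI)
  then obtain V where V: "\<And>n. open (V n)" "\<And>n. V n \<inter> B = (\<lambda>\<psi>. S \<psi> n) -` {..<\<epsilon> / 2 * real n} \<inter> B"
    by blast
  have sub: "B \<subseteq> (\<Union>n\<in>{1..}. V n)"
  proof
    fix \<psi> assume \<psi>: "\<psi> \<in> B"
    have "eventually (\<lambda>n. 1 / real n * S \<psi> n < \<epsilon> / 2) sequentially"
      using order_tendstoD(2)[OF lim[OF \<psi>], of "\<epsilon> / 2"] \<epsilon> by (simp add: S_def)
    \<comment> \<open>\<open>n = 0\<close> satisfies the bound trivially and has to be excluded:
      cutting off an empty piece would stall the induction below.\<close>
    then have "eventually (\<lambda>n. 1 / real n * S \<psi> n < \<epsilon> / 2 \<and> 1 \<le> n) sequentially"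
      by (rule eventually_conj[OF _ eventually_ge_at_top])
    then obtain n where n: "1 / real n * S \<psi> n < \<epsilon> / 2" "1 \<le> n"
      using eventually_happens'[OF sequentially_bot] by blast
    then have "S \<psi> n < \<epsilon> / 2 * real n" by (simp add: field_simps)
    then have "\<psi> \<in> V n \<inter> B" unfolding V(2) using \<psi> by simp
    then show "\<psi> \<in> (\<Union>n\<in>{1..}. V n)" using n(2) by auto
  qed
  obtain C where C: "C \<subseteq> {1..}" "finite C" "B \<subseteq> (\<Union>n\<in>C. V n)"
    by (rule compactE_image[OF B V(1) sub])
  \<comment> \<open>Inserting 1 gives the maximum a meaning when \<open>C\<close> is empty, which
    happens for empty \<open>B\<close>.\<close>
  define L where "L = Max (insert 1 C)"
  have cover: "\<exists>n. 1 \<le> n \<and> n \<le> L \<and> S \<psi> n \<le> \<epsilon> / 2 * real n" if \<psi>: "\<psi> \<in> B" for \<psi>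
  proof -
    obtain n where n: "n \<in> C" "\<psi> \<in> V n" using C \<psi> by blast
    then have "\<psi> \<in> V n \<inter> B" using \<psi> by simp
    then have "S \<psi> n \<le> \<epsilon> / 2 * real n" unfolding V(2) by simp
    moreover have "n \<le> L" unfolding L_def using n C by auto
    ultimately show ?thesis using n C by auto
  qed
  have shift': "\<exists>\<psi>'\<in>B. \<forall>k. g \<psi>' k = g \<psi> (k + m)" if "\<psi> \<in> B" for \<psi> m
  proof (induction m)
    case (Suc m)
    then obtain \<psi>' where \<psi>': "\<psi>' \<in> B" "\<forall>k. g \<psi>' k = g \<psi> (k + m)" by blast
    from shift[OF \<psi>'(1)] obtain \<psi>'' where "\<psi>'' \<in> B" "\<forall>k. g \<psi>'' k = g \<psi>' (Suc k)" by blast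
    then show ?case using \<psi>'(2) by (intro bexI[of _ "\<psi>''"]) simp_all
  next
    case 0
    show ?case using that by (intro bexI[of _ \<psi>]) simp_all
  qed
  \<comment> \<open>Cut pieces have mean at most \<open>\<epsilon> / 2\<close>. The rest has at most
    \<open>L\<close> terms, and its termwise bound \<open>L M\<close> does not depend on
    \<open>n\<close>, so for large \<open>n\<close> the other half of \<open>\<epsilon>\<close>
    absorbs it.\<close>
  have main: "S \<psi> n \<le> \<epsilon> / 2 * real n + real L * M" if "\<psi> \<in> B" for \<psi> n
    using that
  proof (induction n arbitrary: \<psi> rule: less_induct)
    case (less n)
    show ?case
    proof (cases "n \<le> L")
      case True
      have "S \<psi> n \<le> real n * M"
        using sum_bounded_above[of "{..<n}" "g \<psi>" M] bd[OF less.prems] by (simp add: S_def)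
      also have "\<dots> \<le> real L * M" using True M by (intro mult_right_mono) auto
      finally show ?thesis using \<epsilon> by (simp add: add_increasing)
    next
      case False
      obtain m where m: "1 \<le> m" "m \<le> L" "S \<psi> m \<le> \<epsilon> / 2 * real m" using cover[OF less.prems] by blast
      obtain \<psi>' where \<psi>': "\<psi>' \<in> B" "\<forall>k. g \<psi>' k = g \<psi> (k + m)" using shift'[OF less.prems] by blast
      obtain d where n: "n = m + d" using m(2) False by (metis le_iff_add nat_le_linear order_trans)
      have "S \<psi> n = S \<psi> m + (\<Sum>k=m..<m + d. g \<psi> k)"
        unfolding S_def n using sum.atLeastLessThan_concat[of 0 m "m + d" "g \<psi>"] by (simp add: lessThan_atLeast0)
      also have "(\<Sum>k=m..<m + d. g \<psi> k) = S \<psi>' d"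
        unfolding S_def using sum.shift_bounds_nat_ivl[of "g \<psi>" 0 m d] \<psi>'(2)
        by (simp add: lessThan_atLeast0 add.commute)
      also have "\<dots> \<le> \<epsilon> / 2 * real d + real L * M"
        using m(1) n \<psi>'(1) by (intro less.IH) auto
      finally have "S \<psi> n \<le> \<epsilon> / 2 * (real m + real d) + real L * M"
        using m(3) by (simp add: distrib_left)
      also have "real m + real d = real n" unfolding n by simp
      finally show ?thesis .
    qed
  qed
  obtain N where N: "real L * M / (\<epsilon> / 2) < real N" using reals_Archimedean2 by blast
  show ?thesis
  proof (intro exI[of _ "max 1 N"] allI ballI impI)
    fix n \<psi> assume n: "max 1 N \<le> n" and "\<psi> \<in> B"
    have "real L * M < \<epsilon> / 2 * real N" using N \<epsilon> by (simp add: field_simps)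
    also have "\<dots> \<le> \<epsilon> / 2 * real n" using n \<epsilon> by simp
    finally have "S \<psi> n \<le> \<epsilon> * real n" using main[OF \<open>\<psi> \<in> B\<close>, of n] by simp
    then show "1 / real n * (\<Sum>k<n. g \<psi> k) \<le> \<epsilon>" using n by (simp add: S_def field_simps)
  qed
qed

lemma continuous_on_coordinate: "continuous_on S (\<lambda>f :: 'b \<Rightarrow> complex. f x)"
  by (rule continuous_on_subset[OF continuous_on_product_coordinates]) simp

lemma tendsto_coordinate: "(f \<longlongrightarrow> l) G \<Longrightarrow> ((\<lambda>n. f n x) \<longlongrightarrow> (l x :: complex)) G"
  using continuous_on_tendsto_compose[OF continuous_on_coordinate[of UNIV x]] by fastforce

context cstar_algebra
begin

section \<open>Algebra and norm\<close>

lemma is_ring: "Ring.ring A" ..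

lemma add_closed [simp]: "x \<in> carrier A \<Longrightarrow> y \<in> carrier A \<Longrightarrow> x \<oplus> y \<in> carrier A"
  and mult_closed [simp]: "x \<in> carrier A \<Longrightarrow> y \<in> carrier A \<Longrightarrow> x \<otimes> y \<in> carrier A"
  by auto

lemmas add_assoc = ring.ring_simprules(7) [OF is_ring]
lemmas add_comm = ring.ring_simprules(10) [OF is_ring]
lemmas add_left_comm = ring.ring_simprules(22) [OF is_ring]
lemmas add_ac = add_assoc add_comm add_left_comm
lemmas mult_assoc = ring.ring_simprules(11) [OF is_ring]
lemmas distrib_left = ring.ring_simprules(23) [OF is_ring]
lemmas distrib_right = ring.ring_simprules(13) [OF is_ring]
lemmas diff_eq = ring.ring_simprules(14) [OF is_ring]
lemmas neg_unique = abelian_group.minus_equality [OF ring.is_abelian_group, OF is_ring]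

lemma scalar_closed [simp]: "x \<in> carrier A \<Longrightarrow> c \<odot> x \<in> carrier A"
  by (simp add: ring_of_type_algebra_def)

lemma scalar_left_distrib: "x \<in> carrier A \<Longrightarrow> (c + d) \<odot> x = c \<odot> x \<oplus> d \<odot> x"
  using smult_l_distr[of c d x] by (simp add: ring_of_type_algebra_def)

lemma scalar_right_distrib:
  "x \<in> carrier A \<Longrightarrow> y \<in> carrier A \<Longrightarrow> c \<odot> (x \<oplus> y) = c \<odot> x \<oplus> c \<odot> y"
  using smult_r_distr[of c x y] by (simp add: ring_of_type_algebra_def)

lemma scalar_scalar [simp]: "x \<in> carrier A \<Longrightarrow> c \<odot> (d \<odot> x) = (c * d) \<odot> x"
  using smult_assoc1[of c d x] by (simp add: ring_of_type_algebra_def)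

lemma scalar_one [simp]: "x \<in> carrier A \<Longrightarrow> 1 \<odot> x = x"
  using smult_one[of x] by (simp add: ring_of_type_algebra_def)

lemma scalar_zero_left [simp]: "x \<in> carrier A \<Longrightarrow> 0 \<odot> x = \<zero>"
  using smult_l_null[of x] by (simp add: ring_of_type_algebra_def)

lemma scalar_zero_right [simp]: "c \<odot> \<zero> = \<zero>"
  using smult_r_null[of c] by (simp add: ring_of_type_algebra_def)

lemma neg_scalar: "x \<in> carrier A \<Longrightarrow> \<ominus> x = (-1) \<odot> x"
  using scalar_left_distrib[of x "-1" 1] by (intro neg_unique) auto

lemma diff_scalar: "x \<in> carrier A \<Longrightarrow> y \<in> carrier A \<Longrightarrow> x \<ominus> y = x \<oplus> (-1) \<odot> y"
  by (simp add: diff_eq neg_scalar)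

lemmas star_closed [simp] star_star [simp]
lemmas vector_simps = diff_scalar scalar_right_distrib smult_mult_left
  smult_mult_right star_smult star_add star_mult add_assoc mult_assoc distrib_left distrib_right

lemma add_scalar_same:
  assumes "x \<in> carrier A"
  shows "x \<oplus> x = 2 \<odot> x" "x \<oplus> c \<odot> x = (1 + c) \<odot> x" "c \<odot> x \<oplus> x = (c + 1) \<odot> x"
    "c \<odot> x \<oplus> d \<odot> x = (c + d) \<odot> x"
  using assms scalar_left_distrib[of x 1 1] scalar_left_distrib[of x 1 c] scalar_left_distrib[of x c 1]
    scalar_left_distrib[of x c d]
  by auto

lemma add_scalar_same_left:
  assumes "x \<in> carrier A" "y \<in> carrier A"
  shows "x \<oplus> (x \<oplus> y) = 2 \<odot> x \<oplus> y" "x \<oplus> (c \<odot> x \<oplus> y) = (1 + c) \<odot> x \<oplus> y"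
    "c \<odot> x \<oplus> (x \<oplus> y) = (c + 1) \<odot> x \<oplus> y" "c \<odot> x \<oplus> (d \<odot> x \<oplus> y) = (c + d) \<odot> x \<oplus> y"
  using assms by (simp_all add: add_scalar_same flip: add_assoc)

text \<open>With sums associated to the right and equal elements made adjacent, these rules merge
  multiples of one element, the algebra's substitute for linear arithmetic.\<close>

lemmas collect = add_scalar_same add_scalar_same_left

lemma diff_self [simp]: "x \<in> carrier A \<Longrightarrow> x \<ominus> x = \<zero>"
  by (simp add: diff_scalar collect)

lemma diff_add_cancel [simp]: "x \<in> carrier A \<Longrightarrow> y \<in> carrier A \<Longrightarrow> (x \<ominus> y) \<oplus> y = x"
  by (simp add: diff_scalar add_assoc collect)

lemma diff_eq_zero_iff: "x \<in> carrier A \<Longrightarrow> y \<in> carrier A \<Longrightarrow> x \<ominus> y = \<zero> \<longleftrightarrow> x = y"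
  using diff_add_cancel[of x y] by auto

lemma diff_closed [simp]: "x \<in> carrier A \<Longrightarrow> y \<in> carrier A \<Longrightarrow> x \<ominus> y \<in> carrier A"
  by (simp add: diff_scalar)

lemma cnorm_zero [simp]: "cnorm A \<zero> = 0"
  by (simp add: norm_eq_zero_iff)

lemma cnorm_diff_le: "x \<in> carrier A \<Longrightarrow> y \<in> carrier A \<Longrightarrow> cnorm A (x \<ominus> y) \<le> cnorm A x + cnorm A y"
  using norm_add[of x "(-1) \<odot> y"] by (simp add: diff_scalar norm_smult)

lemma cnorm_diff_commute: "x \<in> carrier A \<Longrightarrow> y \<in> carrier A \<Longrightarrow> cnorm A (x \<ominus> y) = cnorm A (y \<ominus> x)"
proof -
  assume "x \<in> carrier A" "y \<in> carrier A"
  then have "y \<ominus> x = (-1) \<odot> (x \<ominus> y)" by (simp add: vector_simps add_comm)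
  then show ?thesis using \<open>x \<in> carrier A\<close> \<open>y \<in> carrier A\<close> by (simp add: norm_smult)
qed

text \<open>Cancelling \<open>|x|\<close> in \<open>|x|^2 = |x* x| <= |x*| |x|\<close> gives one
  inequality; the other is the same with \<open>x*\<close> for \<open>x\<close>.\<close>

lemma cnorm_star [simp]:
  assumes x: "x \<in> carrier A" shows "cnorm A (star A x) = cnorm A x"
proof -
  have *: "cnorm A x \<le> cnorm A (star A x)" if x: "x \<in> carrier A" for x
  proof (cases "cnorm A x = 0")
    case False
    have "(cnorm A x)\<^sup>2 \<le> cnorm A (star A x) * cnorm A x"
      using norm_mult[of "star A x" x] x by (simp add: cstar_identity)
    then show ?thesis using False norm_nonneg[OF x] by (simp add: power2_eq_square)
  qed (use norm_nonneg x in auto)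
  show ?thesis using *[OF x] *[of "star A x"] x by simp
qed

lemma star_one [simp]: "star A \<one> = \<one>"
proof -
  have "star A \<one> = star A (star A \<one> \<otimes> \<one>)" by (subst star_mult) auto
  then show ?thesis using star_closed[of \<one>] by simp
qed

lemma star_zero [simp]: "star A \<zero> = \<zero>"
  using star_smult[of \<one> 0] by simp

text \<open>By the C*-identity \<open>|1|\<close> is idempotent, hence 0 or 1; the value 0 occurs in
  the zero algebra.\<close>

lemma cnorm_one_le: "cnorm A \<one> \<le> 1"
proof -
  have "cnorm A \<one> = (cnorm A \<one>)\<^sup>2"
    using cstar_identity[of \<one>] by simp
  then have "cnorm A \<one> * (cnorm A \<one> - 1) = 0"
    by (simp add: power2_eq_square algebra_simps)
  then show ?thesis by auto
qed

section \<open>Norm limits\<close>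

definition norm_limit :: "(nat \<Rightarrow> 'a) \<Rightarrow> 'a \<Rightarrow> bool" where
  "norm_limit s x \<longleftrightarrow> range s \<subseteq> carrier A \<and> x \<in> carrier A \<and> (\<lambda>n. cnorm A (s n \<ominus> x)) \<longlonglongrightarrow> 0"

lemma norm_limitI:
  assumes "\<And>n. s n \<in> carrier A" "x \<in> carrier A" "\<And>n. cnorm A (s n \<ominus> x) \<le> g n" "g \<longlonglongrightarrow> 0"
  shows "norm_limit s x"
  unfolding norm_limit_def
  using assms norm_nonneg by (auto intro!: tendsto_sandwich[OF _ _ tendsto_const assms(4)] always_eventually)

lemma norm_limitD:
  assumes "norm_limit s x"
  shows "s n \<in> carrier A" "x \<in> carrier A" "(\<lambda>n. cnorm A (s n \<ominus> x)) \<longlonglongrightarrow> 0"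
  using assms by (auto simp: norm_limit_def)

lemma cnorm_triangle_diff:
  assumes "x \<in> carrier A" "y \<in> carrier A" "z \<in> carrier A"
  shows "cnorm A (x \<ominus> z) \<le> cnorm A (x \<ominus> y) + cnorm A (y \<ominus> z)"
proof -
  have "x \<ominus> z = (x \<ominus> y) \<oplus> (y \<ominus> z)" using assms by (simp add: diff_scalar add_assoc collect)
  then show ?thesis using norm_add[of "x \<ominus> y" "y \<ominus> z"] assms by simp
qed

lemma norm_limit_unique:
  assumes "norm_limit s x" "norm_limit s y" shows "x = y"
proof -
  note c = norm_limitD[OF assms(1)] norm_limitD[OF assms(2)]
  have "cnorm A (x \<ominus> y) \<le> cnorm A (s n \<ominus> x) + cnorm A (s n \<ominus> y)" for n
    using cnorm_triangle_diff[of x "s n" y] cnorm_diff_commute[of x "s n"] c by simp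
  moreover have "(\<lambda>n. cnorm A (s n \<ominus> x) + cnorm A (s n \<ominus> y)) \<longlonglongrightarrow> 0"
    using tendsto_add[OF c(3) c(6)] by simp
  ultimately have "cnorm A (x \<ominus> y) \<le> 0" by (intro LIMSEQ_le_const[where X="\<lambda>n. cnorm A (s n \<ominus> x) + cnorm A (s n \<ominus> y)"]) auto
  then have "cnorm A (x \<ominus> y) = 0" using norm_nonneg[of "x \<ominus> y"] c by simp
  then show ?thesis using c by (simp add: norm_eq_zero_iff diff_eq_zero_iff)
qed

lemma norm_limit_const: "x \<in> carrier A \<Longrightarrow> norm_limit (\<lambda>_. x) x"
  by (rule norm_limitI[where g="\<lambda>_. 0"]) auto

lemma norm_limit_Suc: "norm_limit s x \<Longrightarrow> norm_limit (\<lambda>n. s (Suc n)) x"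
  using LIMSEQ_Suc unfolding norm_limit_def by blast

lemma norm_limit_star:
  assumes "norm_limit s x" shows "norm_limit (\<lambda>n. star A (s n)) (star A x)"
proof -
  note c = norm_limitD[OF assms]
  have "star A y \<ominus> star A x = star A (y \<ominus> x)" if "y \<in> carrier A" for y
    using that c by (simp add: vector_simps)
  then have "cnorm A (star A (s n) \<ominus> star A x) = cnorm A (s n \<ominus> x)" for n
    using c by simp
  then show ?thesis using c by (simp add: norm_limit_def image_subset_iff)
qed

lemma norm_limit_add:
  assumes "norm_limit s x" "norm_limit t y" shows "norm_limit (\<lambda>n. s n \<oplus> t n) (x \<oplus> y)"
proof (rule norm_limitI)
  note c = norm_limitD[OF assms(1)] norm_limitD[OF assms(2)]
  fix n
  show "s n \<oplus> t n \<in> carrier A" "x \<oplus> y \<in> carrier A" using c by auto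
  have "(s n \<oplus> t n) \<ominus> (x \<oplus> y) = (s n \<ominus> x) \<oplus> (t n \<ominus> y)"
    using c by (simp add: diff_scalar scalar_right_distrib add_ac)
  then show "cnorm A ((s n \<oplus> t n) \<ominus> (x \<oplus> y)) \<le> cnorm A (s n \<ominus> x) + cnorm A (t n \<ominus> y)"
    using c norm_add by simp
next
  show "(\<lambda>n. cnorm A (s n \<ominus> x) + cnorm A (t n \<ominus> y)) \<longlonglongrightarrow> 0"
    using tendsto_add[OF norm_limitD(3)[OF assms(1)] norm_limitD(3)[OF assms(2)]] by simp
qed

lemma norm_limit_scalar:
  assumes "norm_limit s x" shows "norm_limit (\<lambda>n. c \<odot> s n) (c \<odot> x)"
proof (rule norm_limitI)
  note c = norm_limitD[OF assms(1)]
  fix n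
  show "c \<odot> s n \<in> carrier A" "c \<odot> x \<in> carrier A" using c by auto
  have "c \<odot> s n \<ominus> c \<odot> x = c \<odot> (s n \<ominus> x)"
    using c by (simp add: diff_scalar scalar_right_distrib mult.commute)
  then show "cnorm A (c \<odot> s n \<ominus> c \<odot> x) \<le> cmod c * cnorm A (s n \<ominus> x)"
    using c norm_smult by simp
next
  show "(\<lambda>n. cmod c * cnorm A (s n \<ominus> x)) \<longlonglongrightarrow> 0"
    using tendsto_mult_right_zero[OF norm_limitD(3)[OF assms(1)]] by simp
qed

lemma cnorm_norm_limit:
  assumes "norm_limit s x" shows "(\<lambda>n. cnorm A (s n)) \<longlonglongrightarrow> cnorm A x"
proof (rule Lim_transform2[OF tendsto_const])
  note c = norm_limitD[OF assms(1)]
  have "norm (cnorm A x - cnorm A (s n)) \<le> cnorm A (s n \<ominus> x)" for n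
    using norm_add[of "s n \<ominus> x" x] norm_add[of "x \<ominus> s n" "s n"] cnorm_diff_commute[of x "s n"] c
    by (auto simp: abs_le_iff)
  then show "(\<lambda>n. cnorm A x - cnorm A (s n)) \<longlonglongrightarrow> 0"
    by (rule Lim_null_comparison[OF always_eventually[OF allI] c(3)])
qed

lemma norm_limit_mult:
  assumes "norm_limit s x" "norm_limit t y" shows "norm_limit (\<lambda>n. s n \<otimes> t n) (x \<otimes> y)"
proof (rule norm_limitI)
  note c = norm_limitD[OF assms(1)] norm_limitD[OF assms(2)]
  fix n
  show "s n \<otimes> t n \<in> carrier A" "x \<otimes> y \<in> carrier A" using c by auto
  have "(s n \<otimes> t n) \<ominus> (x \<otimes> y) = (s n \<ominus> x) \<otimes> t n \<oplus> x \<otimes> (t n \<ominus> y)"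
    using c by (simp add: diff_scalar smult_mult_left smult_mult_right distrib_left distrib_right add_assoc collect)
  then have "cnorm A ((s n \<otimes> t n) \<ominus> (x \<otimes> y)) \<le> cnorm A ((s n \<ominus> x) \<otimes> t n) + cnorm A (x \<otimes> (t n \<ominus> y))"
    using c norm_add by simp
  also have "\<dots> \<le> cnorm A (s n \<ominus> x) * cnorm A (t n) + cnorm A x * cnorm A (t n \<ominus> y)"
    using c by (intro add_mono norm_mult) auto
  finally show "cnorm A ((s n \<otimes> t n) \<ominus> (x \<otimes> y)) \<le> cnorm A (s n \<ominus> x) * cnorm A (t n) + cnorm A x * cnorm A (t n \<ominus> y)" .
next
  show "(\<lambda>n. cnorm A (s n \<ominus> x) * cnorm A (t n) + cnorm A x * cnorm A (t n \<ominus> y)) \<longlonglongrightarrow> 0"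
    by (rule tendsto_eq_intros norm_limitD(3)[OF assms(1)] norm_limitD(3)[OF assms(2)] cnorm_norm_limit assms refl)+ simp
qed

text \<open>Majorant argument: the increments of the real sequence \<open>a\<close> dominate the
  steps of \<open>s\<close>, and both telescope, so \<open>s\<close> inherits the Cauchy
  property.\<close>

lemma norm_limit_exists:
  assumes "\<And>n. s n \<in> carrier A"
    and "\<And>n. cnorm A (s (Suc n) \<ominus> s n) \<le> a (Suc n) - a n" and "Cauchy a"
  shows "\<exists>x. norm_limit s x"
proof -
  have le: "cnorm A (s (n + k) \<ominus> s n) \<le> a (n + k) - a n" for n k
  proof (induction k)
    case (Suc k)
    have "cnorm A (s (n + Suc k) \<ominus> s n) \<le> cnorm A (s (n + Suc k) \<ominus> s (n + k)) + cnorm A (s (n + k) \<ominus> s n)"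
      by (rule cnorm_triangle_diff) (use assms in auto)
    then show ?case using Suc assms(2)[of "n + k"] by simp
  qed (use assms in auto)
  have le': "cnorm A (s m \<ominus> s n) \<le> dist (a m) (a n)" for m n
  proof (cases "n \<le> m")
    case True then show ?thesis using le[of n "m - n"] by (simp add: dist_real_def)
  next
    case False then show ?thesis using le[of m "n - m"] cnorm_diff_commute[of "s m" "s n"] assms(1)
      by (simp add: dist_real_def)
  qed
  have "\<exists>y\<in>carrier A. (\<lambda>n. cnorm A (s n \<ominus> y)) \<longlonglongrightarrow> 0"
  proof (rule norm_complete[OF assms(1)])
    fix \<epsilon> :: real assume "0 < \<epsilon>"
    then obtain N where "\<forall>m\<ge>N. \<forall>n\<ge>N. dist (a m) (a n) < \<epsilon>"
      using \<open>Cauchy a\<close> unfolding Cauchy_def by blast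
    then show "\<exists>N. \<forall>m\<ge>N. \<forall>n\<ge>N. cnorm A (s m \<ominus> s n) < \<epsilon>"
      using le' le_less_trans by blast
  qed
  then show ?thesis using assms(1) unfolding norm_limit_def by blast
qed

section \<open>Self-adjoint elements and the iteration for square roots\<close>

definition self_adjoint :: "'a \<Rightarrow> bool" where
  "self_adjoint h \<longleftrightarrow> h \<in> carrier A \<and> star A h = h"

lemma self_adjointD: "self_adjoint h \<Longrightarrow> h \<in> carrier A" "self_adjoint h \<Longrightarrow> star A h = h"
  by (auto simp: self_adjoint_def)

lemma self_adjoint_one: "self_adjoint \<one>" and self_adjoint_zero: "self_adjoint \<zero>"
  by (auto simp: self_adjoint_def)

lemma self_adjoint_add: "self_adjoint g \<Longrightarrow> self_adjoint h \<Longrightarrow> self_adjoint (g \<oplus> h)"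
  by (auto simp: self_adjoint_def star_add)

lemma self_adjoint_scalar: "self_adjoint h \<Longrightarrow> self_adjoint (complex_of_real c \<odot> h)"
  by (auto simp: self_adjoint_def star_smult)

lemma self_adjoint_diff: "self_adjoint g \<Longrightarrow> self_adjoint h \<Longrightarrow> self_adjoint (g \<ominus> h)"
  using self_adjoint_scalar[of h "-1"] self_adjoint_add[of g "(-1) \<odot> h"]
  by (auto simp: self_adjoint_def diff_scalar)

lemma self_adjoint_mult: "self_adjoint g \<Longrightarrow> self_adjoint h \<Longrightarrow> g \<otimes> h = h \<otimes> g \<Longrightarrow> self_adjoint (g \<otimes> h)"
  by (auto simp: self_adjoint_def star_mult)

lemma cnorm_square: "self_adjoint h \<Longrightarrow> cnorm A (h \<otimes> h) = (cnorm A h)\<^sup>2"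
  using cstar_identity[of h] by (simp add: self_adjoint_def)

text \<open>Fixed-point iteration for \<open>s = (y + s s) / 2\<close>, an equation equivalent to
  \<open>(1 - s)(1 - s) = 1 - y\<close>. The limit therefore yields the root \<open>1 - s\<close> of
  \<open>1 - y\<close>.\<close>

fun sqrt_iter :: "'a \<Rightarrow> nat \<Rightarrow> 'a" where
  "sqrt_iter y 0 = \<zero>"
| "sqrt_iter y (Suc n) = (1/2) \<odot> (y \<oplus> sqrt_iter y n \<otimes> sqrt_iter y n)"

text \<open>The same iteration for the scalar \<open>y = 1\<close>. It serves as majorant for every
  \<open>y\<close> of norm at most 1, including norm exactly 1, where no geometric contraction is
  available; it converges because it is increasing and bounded.\<close>

fun sqrt_iter_bound :: "nat \<Rightarrow> real" where
  "sqrt_iter_bound 0 = 0"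
| "sqrt_iter_bound (Suc n) = (1/2) * (1 + sqrt_iter_bound n * sqrt_iter_bound n)"

lemma sqrt_iter_bound_range: "0 \<le> sqrt_iter_bound n \<and> sqrt_iter_bound n \<le> 1"
  by (induction n) (auto simp: mult_le_one)

lemma sqrt_iter_bound_mono: "sqrt_iter_bound n \<le> sqrt_iter_bound (Suc n)"
  using sum_squares_ge_zero[of "1 - sqrt_iter_bound n" 0] by (auto simp: algebra_simps)

lemma Cauchy_sqrt_iter_bound: "Cauchy sqrt_iter_bound"
proof (intro convergent_Cauchy Bseq_mono_convergent BseqI'[where K=1])
  show "norm (sqrt_iter_bound n) \<le> 1" for n
    using sqrt_iter_bound_range[of n] by simp
  show "\<forall>m. \<forall>n\<ge>m. sqrt_iter_bound m \<le> sqrt_iter_bound n"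
    using lift_Suc_mono_le[of sqrt_iter_bound] sqrt_iter_bound_mono by blast
qed

lemma add_diff_add_cancel:
  assumes "x \<in> carrier A" "y \<in> carrier A" "z \<in> carrier A"
  shows "(x \<oplus> y) \<ominus> (x \<oplus> z) = y \<ominus> z"
proof -
  have "(x \<oplus> y) \<ominus> (x \<oplus> z) = (y \<oplus> x) \<oplus> (-1) \<odot> (x \<oplus> z)"
    using assms by (simp add: diff_scalar add_comm)
  also have "\<dots> = y \<oplus> (-1) \<odot> z"
    using assms by (simp add: scalar_right_distrib add_assoc collect)
  finally show ?thesis using assms by (simp add: diff_scalar)
qed

lemma scalar_diff: "x \<in> carrier A \<Longrightarrow> y \<in> carrier A \<Longrightarrow> c \<odot> (x \<ominus> y) = c \<odot> x \<ominus> c \<odot> y"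
  by (simp add: diff_scalar scalar_right_distrib mult.commute)

lemma square_diff:
  "x \<in> carrier A \<Longrightarrow> y \<in> carrier A \<Longrightarrow> x \<otimes> x \<ominus> y \<otimes> y = x \<otimes> (x \<ominus> y) \<oplus> (x \<ominus> y) \<otimes> y"
  by (simp add: diff_scalar smult_mult_left smult_mult_right distrib_left distrib_right add_assoc collect)

lemma sqrt_iter_props:
  assumes y: "self_adjoint y" "cnorm A y \<le> 1"
  shows "self_adjoint (sqrt_iter y n)" "cnorm A (sqrt_iter y n) \<le> sqrt_iter_bound n"
proof (induction n)
  case (Suc n)
  {
    case 1
    show ?case using Suc y self_adjoint_scalar[of _ "1/2"] by (auto intro!: self_adjoint_add self_adjoint_mult)
  next
    case 2
    let ?s = "sqrt_iter y n"
    have [simp]: "?s \<in> carrier A" "y \<in> carrier A" using Suc y self_adjointD by auto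
    have "cnorm A (y \<oplus> ?s \<otimes> ?s) \<le> cnorm A y + cnorm A ?s * cnorm A ?s"
      using norm_add[of y "?s \<otimes> ?s"] norm_mult[of ?s ?s] by simp
    also have "\<dots> \<le> 1 + sqrt_iter_bound n * sqrt_iter_bound n"
      using Suc y norm_nonneg[of ?s] by (intro add_mono mult_mono) auto
    finally show ?case by (simp add: norm_smult)
  }
qed (auto simp: self_adjoint_zero)

text \<open>The identity \<open>t t - s s = t (t - s) + (t - s) s\<close> holds without
  commutativity. Its scalar version computes the next increment of the majorant, so the estimate
  passes from one step to the next without loss.\<close>

lemma sqrt_iter_step:
  assumes y: "self_adjoint y" "cnorm A y \<le> 1"
  shows "cnorm A (sqrt_iter y (Suc n) \<ominus> sqrt_iter y n) \<le> sqrt_iter_bound (Suc n) - sqrt_iter_bound n"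
proof (induction n)
  case 0
  have "y \<in> carrier A" using y self_adjointD by auto
  then show ?case using y by (simp add: diff_scalar norm_smult)
next
  case (Suc n)
  let ?s = "sqrt_iter y n" and ?t = "sqrt_iter y (Suc n)"
  let ?b = "sqrt_iter_bound n" and ?c = "sqrt_iter_bound (Suc n)"
  note pr = sqrt_iter_props[OF y]
  have [simp]: "?s \<in> carrier A" "?t \<in> carrier A" "y \<in> carrier A" using pr y self_adjointD by blast+
  have eq: "sqrt_iter y (Suc (Suc n)) \<ominus> ?t = (1/2) \<odot> (?t \<otimes> (?t \<ominus> ?s) \<oplus> (?t \<ominus> ?s) \<otimes> ?s)"
  proof -
    have "(1/2) \<odot> (y \<oplus> t \<otimes> t) \<ominus> (1/2) \<odot> (y \<oplus> s \<otimes> s) = (1/2) \<odot> (t \<otimes> (t \<ominus> s) \<oplus> (t \<ominus> s) \<otimes> s)"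
      if "s \<in> carrier A" "t \<in> carrier A" for s t
      using that by (simp add: add_diff_add_cancel square_diff flip: scalar_diff)
    from this[of ?s ?t] show ?thesis by simp
  qed
  have "cnorm A (sqrt_iter y (Suc (Suc n)) \<ominus> ?t) = (1/2) * cnorm A (?t \<otimes> (?t \<ominus> ?s) \<oplus> (?t \<ominus> ?s) \<otimes> ?s)"
    unfolding eq by (subst norm_smult) auto
  also have "\<dots> \<le> (1/2) * (cnorm A ?t * cnorm A (?t \<ominus> ?s) + cnorm A (?t \<ominus> ?s) * cnorm A ?s)"
    by (intro mult_left_mono order_trans[OF norm_add] add_mono norm_mult)
       (simp_all del: sqrt_iter.simps)
  also have "\<dots> \<le> (1/2) * (?c * (?c - ?b) + (?c - ?b) * ?b)"
    using pr Suc.IH norm_nonneg[of ?t] norm_nonneg[of ?s] norm_nonneg[of "?t \<ominus> ?s"]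
      sqrt_iter_bound_range sqrt_iter_bound_mono[of n]
    by (intro mult_left_mono add_mono mult_mono) (simp_all del: sqrt_iter.simps sqrt_iter_bound.simps)
  also have "\<dots> = sqrt_iter_bound (Suc (Suc n)) - ?c"
    by (simp add: field_simps)
  finally show ?case .
qed

text \<open>Commutation with \<open>y\<close> survives the iteration and then the limit; this is
  what later makes roots of commuting positive elements commute.\<close>

lemma sqrt_iter_commute:
  assumes "y \<in> carrier A" "c \<in> carrier A" "c \<otimes> y = y \<otimes> c"
  shows "sqrt_iter y n \<in> carrier A \<and> c \<otimes> sqrt_iter y n = sqrt_iter y n \<otimes> c"
proof (induction n)
  case (Suc n)
  let ?s = "sqrt_iter y n"
  have "c \<otimes> (?s \<otimes> ?s) = ?s \<otimes> (?s \<otimes> c)"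
    using Suc assms by (metis mult_assoc)
  then show ?case using Suc assms by (simp add: vector_simps)
qed (use assms in auto)

section \<open>Positive elements\<close>

text \<open>All four properties pass from the iterates to their limit. The bound
  \<open>|s| <= 1\<close> is what makes the root \<open>1 - s\<close> positive in the sense defined
  below.\<close>

lemma sqrt_one_minus:
  assumes y: "self_adjoint y" "cnorm A y \<le> 1"
  obtains s where "self_adjoint s" "cnorm A s \<le> 1" "(\<one> \<ominus> s) \<otimes> (\<one> \<ominus> s) = \<one> \<ominus> y"
    "\<And>c. c \<in> carrier A \<Longrightarrow> c \<otimes> y = y \<otimes> c \<Longrightarrow> c \<otimes> s = s \<otimes> c"
proof -
  note pr = sqrt_iter_props[OF y]
  have [simp]: "y \<in> carrier A" "\<And>n. sqrt_iter y n \<in> carrier A" using pr y self_adjointD by blast+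
  obtain s where lim: "norm_limit (sqrt_iter y) s"
    using norm_limit_exists[of "sqrt_iter y", OF _ sqrt_iter_step[OF y] Cauchy_sqrt_iter_bound] by fastforce
  then have [simp]: "s \<in> carrier A" by (rule norm_limitD)
  have "star A (sqrt_iter y n) = sqrt_iter y n" for n
    using pr(1) by (rule self_adjointD)
  then have "norm_limit (sqrt_iter y) (star A s)" using norm_limit_star[OF lim] by simp
  then have "star A s = s" using lim by (rule norm_limit_unique)
  then have sa: "self_adjoint s" by (simp add: self_adjoint_def)
  have "s = (1/2) \<odot> (y \<oplus> s \<otimes> s)"
  proof (rule norm_limit_unique[OF norm_limit_Suc[OF lim]])
    show "norm_limit (\<lambda>n. sqrt_iter y (Suc n)) ((1/2) \<odot> (y \<oplus> s \<otimes> s))"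
      by (simp, intro norm_limit_scalar norm_limit_add norm_limit_mult lim norm_limit_const) simp
  qed
  then have "2 \<odot> s = y \<oplus> s \<otimes> s"
    using scalar_scalar[of "y \<oplus> s \<otimes> s" 2 "1/2"] by (metis add_closed mult_closed scalar_one
        \<open>s \<in> carrier A\<close> \<open>y \<in> carrier A\<close> nonzero_eq_divide_eq zero_neq_numeral mult.commute)
  then have "s \<otimes> s = 2 \<odot> s \<ominus> y"
    using add_diff_add_cancel[of y "s \<otimes> s" \<zero>] by (simp add: diff_scalar)
  then have sq: "(\<one> \<ominus> s) \<otimes> (\<one> \<ominus> s) = \<one> \<ominus> y"
    by (simp add: diff_scalar smult_mult_left smult_mult_right distrib_left distrib_right
        scalar_right_distrib add_assoc collect)
  have "cnorm A s \<le> 1"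
  proof (rule LIMSEQ_le_const2[OF cnorm_norm_limit[OF lim]])
    show "\<exists>N. \<forall>n\<ge>N. cnorm A (sqrt_iter y n) \<le> 1"
      using pr sqrt_iter_bound_range order_trans by blast
  qed
  moreover have "c \<otimes> s = s \<otimes> c" if c: "c \<in> carrier A" "c \<otimes> y = y \<otimes> c" for c
  proof (rule norm_limit_unique)
    show "norm_limit (\<lambda>n. c \<otimes> sqrt_iter y n) (c \<otimes> s)"
      by (intro norm_limit_mult lim norm_limit_const c)
    show "norm_limit (\<lambda>n. c \<otimes> sqrt_iter y n) (s \<otimes> c)"
    proof -
      have "c \<otimes> sqrt_iter y n = sqrt_iter y n \<otimes> c" for n
        using sqrt_iter_commute[OF _ c, of n] by simp
      then show ?thesis using norm_limit_mult[OF lim norm_limit_const[OF c(1)]] by simp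
    qed
  qed
  ultimately show thesis by (intro that[OF sa _ sq])
qed

text \<open>For self-adjoint \<open>h\<close> the inequality says that the spectrum lies in
  \<open>[0, 2 t]\<close>. In this form the radii \<open>t\<close> simply add under sums, and
  dividing by \<open>t\<close> leads to the hypothesis of \<open>sqrt_one_minus\<close>.\<close>

definition positive :: "'a \<Rightarrow> bool" where
  "positive h \<longleftrightarrow> self_adjoint h \<and> (\<exists>t\<ge>0. cnorm A (complex_of_real t \<odot> \<one> \<ominus> h) \<le> t)"

lemma positive_self_adjoint: "positive h \<Longrightarrow> self_adjoint h" and positive_closed: "positive h \<Longrightarrow> h \<in> carrier A"
  by (auto simp: positive_def self_adjoint_def)

lemma positive_zero: "positive \<zero>"
  by (auto simp: positive_def self_adjoint_zero intro!: exI[of _ 0])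

lemma positive_add:
  assumes "positive g" "positive h" shows "positive (g \<oplus> h)"
proof -
  obtain s t where st: "0 \<le> s" "0 \<le> t" "cnorm A (complex_of_real s \<odot> \<one> \<ominus> g) \<le> s"
    "cnorm A (complex_of_real t \<odot> \<one> \<ominus> h) \<le> t"
    using assms by (auto simp: positive_def)
  have [simp]: "g \<in> carrier A" "h \<in> carrier A" using assms positive_closed by auto
  have "complex_of_real (s + t) \<odot> \<one> \<ominus> (g \<oplus> h) = (complex_of_real s \<odot> \<one> \<ominus> g) \<oplus> (complex_of_real t \<odot> \<one> \<ominus> h)"
    by (simp add: scalar_left_distrib diff_scalar scalar_right_distrib add_ac)
  then have "cnorm A (complex_of_real (s + t) \<odot> \<one> \<ominus> (g \<oplus> h)) \<le> s + t"
    using norm_add[of "complex_of_real s \<odot> \<one> \<ominus> g" "complex_of_real t \<odot> \<one> \<ominus> h"] st by simp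
  then show ?thesis
    using st assms by (auto simp: positive_def intro!: self_adjoint_add exI[of _ "s + t"])
qed

lemma positive_scalar:
  assumes "positive h" "0 \<le> c" shows "positive (complex_of_real c \<odot> h)"
proof -
  obtain t where t: "0 \<le> t" "cnorm A (complex_of_real t \<odot> \<one> \<ominus> h) \<le> t"
    using assms by (auto simp: positive_def)
  have [simp]: "h \<in> carrier A" using assms positive_closed by auto
  have "complex_of_real (c * t) \<odot> \<one> \<ominus> complex_of_real c \<odot> h = complex_of_real c \<odot> (complex_of_real t \<odot> \<one> \<ominus> h)"
    by (simp add: scalar_diff)
  then have "cnorm A (complex_of_real (c * t) \<odot> \<one> \<ominus> complex_of_real c \<odot> h) \<le> c * t"
    using t assms by (simp add: norm_smult mult_left_mono)
  then show ?thesis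
    using t assms by (auto simp: positive_def intro!: self_adjoint_scalar exI[of _ "c * t"])
qed

text \<open>For \<open>t > 0\<close> write \<open>h / t = 1 - y\<close> with
  \<open>|y| \<le> 1\<close>; the root of \<open>1 - y\<close>, rescaled by \<open>sqrt t\<close>,
  is a root of \<open>h\<close>. For \<open>t = 0\<close> the inequality forces
  \<open>h = 0\<close>.\<close>

lemma positive_sqrt:
  assumes "positive h"
  obtains z where "positive z" "z \<otimes> z = h"
    "\<And>c. c \<in> carrier A \<Longrightarrow> c \<otimes> h = h \<otimes> c \<Longrightarrow> c \<otimes> z = z \<otimes> c"
proof -
  obtain t where t: "0 \<le> t" "cnorm A (complex_of_real t \<odot> \<one> \<ominus> h) \<le> t" and h: "self_adjoint h"
    using assms by (auto simp: positive_def)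
  have [simp]: "h \<in> carrier A" using h self_adjointD by auto
  show thesis
  proof (cases "t = 0")
    case True
    then have "cnorm A (\<zero> \<ominus> h) = 0" using t norm_nonneg[of "\<zero> \<ominus> h"] by simp
    then have "h = \<zero>" by (simp add: norm_eq_zero_iff diff_eq_zero_iff)
    then show thesis using that[of \<zero>] positive_zero by simp
  next
    case False
    with t have t0: "0 < t" by simp
    define y where "y = \<one> \<ominus> complex_of_real (1 / t) \<odot> h"
    have y: "self_adjoint y" "y \<in> carrier A"
      unfolding y_def using h by (auto intro!: self_adjoint_diff self_adjoint_one self_adjoint_scalar simp del: of_real_divide)
    have "y = complex_of_real (1 / t) \<odot> (complex_of_real t \<odot> \<one> \<ominus> h)"
      using t0 by (simp add: y_def scalar_diff)
    then have "cnorm A y \<le> 1" using t t0 by (simp add: norm_smult norm_divide field_simps)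
    then obtain s where s: "self_adjoint s" "cnorm A s \<le> 1" "(\<one> \<ominus> s) \<otimes> (\<one> \<ominus> s) = \<one> \<ominus> y"
      "\<And>c. c \<in> carrier A \<Longrightarrow> c \<otimes> y = y \<otimes> c \<Longrightarrow> c \<otimes> s = s \<otimes> c"
      using sqrt_one_minus[OF y(1)] by metis
    have [simp]: "s \<in> carrier A" using s(1) self_adjointD by auto
    have hy: "\<one> \<ominus> y = complex_of_real (1 / t) \<odot> h"
      by (simp add: y_def diff_scalar scalar_right_distrib collect flip: add_assoc)
    define z where "z = complex_of_real (sqrt t) \<odot> (\<one> \<ominus> s)"
    have "z \<otimes> z = complex_of_real (sqrt t * sqrt t) \<odot> ((\<one> \<ominus> s) \<otimes> (\<one> \<ominus> s))"
      by (simp add: z_def smult_mult_left smult_mult_right del: real_sqrt_mult_self)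
    also have "\<dots> = complex_of_real (sqrt t * sqrt t * (1 / t)) \<odot> h"
      unfolding s(3) hy by simp
    also have "\<dots> = h" using t0 by (simp flip: of_real_mult)
    finally have zz: "z \<otimes> z = h" .
    have "complex_of_real (sqrt t) \<odot> \<one> \<ominus> z = complex_of_real (sqrt t) \<odot> s"
      by (simp add: z_def diff_scalar scalar_right_distrib collect flip: add_assoc)
    then have "cnorm A (complex_of_real (sqrt t) \<odot> \<one> \<ominus> z) \<le> sqrt t"
      using s(2) t0 by (simp add: norm_smult)
    then have "positive z"
      unfolding positive_def using t0 s(1)
      by (auto simp: z_def intro!: self_adjoint_scalar self_adjoint_diff self_adjoint_one exI[of _ "sqrt t"])
    moreover have "c \<otimes> z = z \<otimes> c" if c: "c \<in> carrier A" "c \<otimes> h = h \<otimes> c" for c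
    proof -
      have "c \<otimes> y = y \<otimes> c"
        using c by (simp add: y_def diff_scalar smult_mult_left smult_mult_right distrib_left distrib_right)
      then have "c \<otimes> s = s \<otimes> c" using s(4) c by blast
      then show ?thesis
        using c by (simp add: z_def diff_scalar smult_mult_left smult_mult_right distrib_left distrib_right)
    qed
    ultimately show thesis using zz by (intro that)
  qed
qed

text \<open>For commuting self-adjoint \<open>z\<close> and \<open>w\<close> the element \<open>u = z + i w\<close> satisfies
  \<open>u* u = z z + w w\<close> and has real part \<open>z\<close>.\<close>

lemma cnorm_le_sum_squares:
  assumes "self_adjoint z" "self_adjoint w" "z \<otimes> w = w \<otimes> z"
  shows "(cnorm A z)\<^sup>2 \<le> cnorm A (z \<otimes> z \<oplus> w \<otimes> w)"
proof -
  define u where "u = z \<oplus> \<i> \<odot> w"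
  have c [simp]: "z \<in> carrier A" "w \<in> carrier A" "u \<in> carrier A" and st: "star A z = z" "star A w = w"
    using assms self_adjointD by (auto simp: u_def)
  have su: "star A u = z \<oplus> (- \<i>) \<odot> w" by (simp add: u_def star_add star_smult st)
  have "star A u \<otimes> u = z \<otimes> z \<oplus> w \<otimes> w"
    unfolding su by (simp add: u_def assms(3) smult_mult_left smult_mult_right distrib_left distrib_right
      scalar_right_distrib add_assoc collect)
  then have u: "(cnorm A u)\<^sup>2 = cnorm A (z \<otimes> z \<oplus> w \<otimes> w)"
    using cstar_identity[OF c(3)] by simp
  have "2 \<odot> z = u \<oplus> star A u"
    unfolding su by (simp add: u_def add_ac collect)
  then have "2 * cnorm A z = cnorm A (u \<oplus> star A u)" 
    using norm_smult[OF c(1), of 2] by simp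
  also have "\<dots> \<le> 2 * cnorm A u" using norm_add[of u "star A u"] by simp
  finally have "cnorm A z \<le> cnorm A u" by simp
  then show ?thesis using u norm_nonneg[of z] by (metis c(1) power_mono)
qed

text \<open>The radius is \<open>t = |z|^2\<close>. Put \<open>v = z / sqrt t\<close> and let
  \<open>w\<close> be the root of \<open>1 - v v\<close> that commutes with \<open>v\<close>. As
  cosine and sine, \<open>w w + v v = 1\<close>, so \<open>|w|^2 <= |1| <= 1\<close>, which is the
  required bound on \<open>1 - v v\<close>.\<close>

lemma positive_square:
  assumes "self_adjoint z" shows "positive (z \<otimes> z)"
proof -
  have c [simp]: "z \<in> carrier A" using assms self_adjointD by auto
  define t where "t = (cnorm A z)\<^sup>2"
  show ?thesis
  proof (cases "cnorm A z = 0")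
    case True
    then show ?thesis using positive_zero by (simp add: norm_eq_zero_iff)
  next
    case False
    then have t: "0 < t" by (simp add: t_def)
    define y where "y = complex_of_real (1 / t) \<odot> (z \<otimes> z)"
    have sq: "self_adjoint (z \<otimes> z)" by (intro self_adjoint_mult assms refl)
    then have y: "self_adjoint y" "y \<in> carrier A" unfolding y_def by (auto intro!: self_adjoint_scalar simp del: of_real_divide)
    have "cnorm A y \<le> 1" 
      using False by (simp add: y_def norm_smult norm_divide norm_power cnorm_square[OF assms] t_def)
    then obtain s where s: "self_adjoint s" "(\<one> \<ominus> s) \<otimes> (\<one> \<ominus> s) = \<one> \<ominus> y"
      "\<And>c. c \<in> carrier A \<Longrightarrow> c \<otimes> y = y \<otimes> c \<Longrightarrow> c \<otimes> s = s \<otimes> c"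
      using sqrt_one_minus[OF y(1)] by metis
    have [simp]: "s \<in> carrier A" using s(1) self_adjointD by auto
    define w where "w = \<one> \<ominus> s"
    have w: "self_adjoint w" "w \<in> carrier A" using s(1) by (auto simp: w_def intro: self_adjoint_diff self_adjoint_one)
    define v where "v = complex_of_real (1 / sqrt t) \<odot> z"
    have v: "self_adjoint v" "v \<in> carrier A" using assms by (auto simp: v_def intro!: self_adjoint_scalar simp del: of_real_divide)
    have "z \<otimes> y = y \<otimes> z" by (simp add: y_def smult_mult_left smult_mult_right mult_assoc)
    then have "z \<otimes> s = s \<otimes> z" using s(3)[of z] by simp
    then have "w \<otimes> v = v \<otimes> w"
      by (simp add: w_def v_def diff_scalar smult_mult_left smult_mult_right distrib_left distrib_right
          scalar_right_distrib)
    have "complex_of_real (sqrt t) * complex_of_real (sqrt t) = complex_of_real t"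
      using t by (metis of_real_mult real_sqrt_mult_self abs_of_pos)
    then have vv: "v \<otimes> v = y"
      by (simp add: v_def y_def smult_mult_left smult_mult_right mult_assoc)
    have ww: "w \<otimes> w = \<one> \<ominus> y" using s(2) by (simp add: w_def)
    have "(cnorm A w)\<^sup>2 \<le> cnorm A (w \<otimes> w \<oplus> v \<otimes> v)"
      by (rule cnorm_le_sum_squares) fact+
    also have "\<dots> = cnorm A \<one>" unfolding ww vv using y by simp
    finally have "cnorm A (\<one> \<ominus> y) \<le> 1"
      using cnorm_one_le cnorm_square[OF w(1)] ww by simp
    moreover have "complex_of_real t \<odot> \<one> \<ominus> z \<otimes> z = complex_of_real t \<odot> (\<one> \<ominus> y)"
      using t by (simp add: scalar_diff y_def)
    ultimately have "cnorm A (complex_of_real t \<odot> \<one> \<ominus> z \<otimes> z) \<le> t"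
      using t y by (simp add: norm_smult)
    then show ?thesis using t sq unfolding positive_def by (intro conjI exI[of _ t]) auto
  qed
qed

text \<open>Commutation is transferred twice, from \<open>g\<close> to its root \<open>z\<close> and
  then from \<open>h\<close> to its root \<open>w\<close>; commuting roots reduce the claim to sums
  of squares.\<close>

lemma cnorm_mono_commuting:
  assumes "positive g" "positive h" "g \<otimes> h = h \<otimes> g"
  shows "cnorm A g \<le> cnorm A (g \<oplus> h)"
proof -
  obtain z where z: "positive z" "z \<otimes> z = g" "\<And>c. c \<in> carrier A \<Longrightarrow> c \<otimes> g = g \<otimes> c \<Longrightarrow> c \<otimes> z = z \<otimes> c"
    using positive_sqrt[OF assms(1)] by metis
  obtain w where w: "positive w" "w \<otimes> w = h" "\<And>c. c \<in> carrier A \<Longrightarrow> c \<otimes> h = h \<otimes> c \<Longrightarrow> c \<otimes> w = w \<otimes> c"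
    using positive_sqrt[OF assms(2)] by metis
  have "h \<otimes> z = z \<otimes> h"
    using z(3)[of h] positive_closed[OF assms(2)] assms(3) by simp
  then have zw: "z \<otimes> w = w \<otimes> z"
    using w(3)[of z] positive_closed[OF z(1)] by simp
  show ?thesis
    using cnorm_le_sum_squares[OF _ _ zw] cnorm_square[of z] positive_self_adjoint[OF z(1)]
      positive_self_adjoint[OF w(1)] unfolding z(2) w(2) by simp
qed

text \<open>The positive cone is proper: \<open>g = - h\<close> commutes with \<open>h\<close>, so
  monotonicity of the norm bounds \<open>|g|\<close> by \<open>|0|\<close>.\<close>

lemma positive_add_eq_zero:
  assumes "positive g" "positive h" "g \<oplus> h = \<zero>"
  shows "g = \<zero>"
proof -
  have [simp]: "g \<in> carrier A" "h \<in> carrier A" using assms positive_closed by auto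
  have "\<ominus> h = g" using neg_unique[OF assms(3)] by simp
  then have g: "g = (-1) \<odot> h" by (simp add: neg_scalar)
  then have "g \<otimes> h = h \<otimes> g" by (simp add: smult_mult_left smult_mult_right)
  then have "cnorm A g \<le> 0" using cnorm_mono_commuting[OF assms(1,2)] assms(3) by simp
  then show ?thesis using norm_nonneg[of g] norm_eq_zero_iff[of g] by simp
qed

text \<open>Here \<open>p\<close> is twice the real part of \<open>c\<close> and \<open>q\<close> is
  minus twice its imaginary part. In \<open>p p + q q\<close> the terms \<open>c c\<close> and
  \<open>c* c*\<close> cancel. So the symmetric sum is known to be positive before either summand
  is.\<close>

lemma positive_star_mult_add_mult_star:
  assumes c [simp]: "c \<in> carrier A"
  shows "positive (star A c \<otimes> c \<oplus> c \<otimes> star A c)"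
proof -
  define p q where "p = c \<oplus> star A c" and "q = \<i> \<odot> (c \<ominus> star A c)"
  have sa: "self_adjoint p" "self_adjoint q"
    by (simp_all add: self_adjoint_def p_def q_def star_add star_smult diff_scalar scalar_right_distrib add_comm)
  have "p \<otimes> p \<oplus> q \<otimes> q = 2 \<odot> (star A c \<otimes> c \<oplus> c \<otimes> star A c)"
  proof -
    have "p \<otimes> p \<oplus> q \<otimes> q = (c \<otimes> c \<oplus> (-1) \<odot> (c \<otimes> c))
      \<oplus> (star A c \<otimes> star A c \<oplus> (-1) \<odot> (star A c \<otimes> star A c))
      \<oplus> ((star A c \<otimes> c \<oplus> star A c \<otimes> c) \<oplus> (c \<otimes> star A c \<oplus> c \<otimes> star A c))"
      by (simp add: p_def q_def diff_scalar scalar_right_distrib smult_mult_left smult_mult_right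
          distrib_left distrib_right add_ac)
    then show ?thesis by (simp add: collect scalar_right_distrib)
  qed
  then have "star A c \<otimes> c \<oplus> c \<otimes> star A c = complex_of_real (1/2) \<odot> (p \<otimes> p \<oplus> q \<otimes> q)"
    by simp
  then show ?thesis
    using sa by (auto intro!: positive_scalar positive_add positive_square simp del: of_real_divide)
qed

lemma star_mult_eq_zeroD:
  assumes "c \<in> carrier A" "star A c \<otimes> c = \<zero>" shows "c = \<zero>"
  using cstar_identity[of c] assms norm_eq_zero_iff[of c] by simp

lemma square_eq_zeroD: "self_adjoint h \<Longrightarrow> h \<otimes> h = \<zero> \<Longrightarrow> h = \<zero>"
  using star_mult_eq_zeroD[of h] by (simp add: self_adjoint_def)

text \<open>With \<open>r r = n\<close>, \<open>m = c c*\<close> and \<open>e = r c*\<close> one has \<open>e* e = - m m\<close> and \<open>e e* = - n n\<close>, while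
  \<open>e* e + e e*\<close> is positive.\<close>

lemma star_mult_neg_positive_eq_zero:
  assumes c [simp]: "c \<in> carrier A" and n: "positive n" and eq: "star A c \<otimes> c = (-1) \<odot> n"
  shows "c = \<zero>"
proof -
  obtain r where r: "positive r" "r \<otimes> r = n" using positive_sqrt[OF n] by metis
  have [simp]: "r \<in> carrier A" "n \<in> carrier A" and sr: "star A r = r"
    using positive_closed n r(1) self_adjointD positive_self_adjoint by blast+
  define m where "m = c \<otimes> star A c"
  have m: "self_adjoint m" "m \<in> carrier A" by (auto simp: m_def self_adjoint_def star_mult)
  define e where "e = r \<otimes> star A c"
  have e [simp]: "e \<in> carrier A" by (simp add: e_def)
  have se: "star A e = c \<otimes> r" by (simp add: e_def star_mult sr)
  have neg: "n = (-1) \<odot> (star A c \<otimes> c)" unfolding eq by simp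
  have "star A e \<otimes> e = c \<otimes> ((r \<otimes> r) \<otimes> star A c)"
    unfolding se by (simp add: e_def mult_assoc)
  also have "\<dots> = (-1) \<odot> (m \<otimes> m)"
    unfolding r(2) unfolding neg by (simp add: m_def smult_mult_left smult_mult_right mult_assoc)
  finally have ee1: "star A e \<otimes> e = (-1) \<odot> (m \<otimes> m)" .
  have "e \<otimes> star A e = r \<otimes> ((star A c \<otimes> c) \<otimes> r)"
    unfolding se by (simp add: e_def mult_assoc)
  also have "\<dots> = (-1) \<odot> (n \<otimes> n)"
    unfolding eq unfolding r(2)[symmetric] by (simp add: smult_mult_left smult_mult_right mult_assoc)
  finally have ee2: "e \<otimes> star A e = (-1) \<odot> (n \<otimes> n)" .
  \<comment> \<open>Adding the square \<open>n n\<close> to the positive \<open>e* e + e e*\<close>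
    leaves \<open>- m m\<close>. Thus \<open>m m\<close> and its negative are both positive.\<close>
  have "m \<otimes> m = \<zero>"
  proof (rule positive_add_eq_zero)
    show "positive (m \<otimes> m)" by (rule positive_square[OF m(1)])
    show "positive ((star A e \<otimes> e \<oplus> e \<otimes> star A e) \<oplus> n \<otimes> n)"
      using positive_self_adjoint[OF n]
      by (intro positive_add positive_square positive_star_mult_add_mult_star) simp_all
    show "m \<otimes> m \<oplus> ((star A e \<otimes> e \<oplus> e \<otimes> star A e) \<oplus> n \<otimes> n) = \<zero>"
      unfolding ee1 ee2 using m by (simp add: add_assoc collect)
  qed
  then have "m = \<zero>" using square_eq_zeroD m by blast
  then have "star A c = \<zero>" using star_mult_eq_zeroD[of "star A c"] by (simp add: m_def)
  then show ?thesis using star_star[OF c] by simp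
qed

text \<open>With \<open>h = a* a\<close>, \<open>k\<close> the positive root of \<open>h h\<close> and \<open>f = k - h\<close>, the element \<open>c = a f\<close>
  satisfies \<open>c* c = - f k f\<close>, hence vanishes, and this forces \<open>h = k\<close>.\<close>

theorem positive_star_mult:
  assumes a [simp]: "a \<in> carrier A"
  shows "positive (star A a \<otimes> a)"
proof -
  define h where "h = star A a \<otimes> a"
  have h: "self_adjoint h" and [simp]: "h \<in> carrier A"
    by (auto simp: h_def self_adjoint_def star_mult)
  obtain k where k: "positive k" "k \<otimes> k = h \<otimes> h"
    and k_comm: "\<And>c. c \<in> carrier A \<Longrightarrow> c \<otimes> (h \<otimes> h) = (h \<otimes> h) \<otimes> c \<Longrightarrow> c \<otimes> k = k \<otimes> c"
    using positive_sqrt[OF positive_square[OF h]] by metis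
  have [simp]: "k \<in> carrier A" by (rule positive_closed[OF k(1)])
  have hk: "h \<otimes> k = k \<otimes> h" by (rule k_comm) (simp_all add: mult_assoc)
  \<comment> \<open>The root \<open>r\<close> of \<open>k\<close> turns \<open>f k f\<close> into
    the square of the self-adjoint \<open>r f\<close>, whose positivity is already
    available.\<close>
  obtain r where r: "positive r" "r \<otimes> r = k"
    and r_comm: "\<And>c. c \<in> carrier A \<Longrightarrow> c \<otimes> k = k \<otimes> c \<Longrightarrow> c \<otimes> r = r \<otimes> c"
    using positive_sqrt[OF k(1)] by metis
  have [simp]: "r \<in> carrier A" by (rule positive_closed[OF r(1)])
  have hr: "h \<otimes> r = r \<otimes> h" by (rule r_comm) (simp_all add: hk)
  have kr: "k \<otimes> r = r \<otimes> k" by (rule r_comm) simp_all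
  define f where "f = k \<ominus> h"
  have f: "self_adjoint f" unfolding f_def by (intro self_adjoint_diff positive_self_adjoint k h)
  then have [simp]: "f \<in> carrier A" by (rule self_adjointD)
  have fr: "r \<otimes> f = f \<otimes> r"
    by (simp add: f_def diff_scalar smult_mult_left smult_mult_right distrib_left distrib_right hr kr)
  \<comment> \<open>From \<open>h h = k k\<close> and \<open>h k = k h\<close>. Heuristically
    \<open>k\<close> is the absolute value of \<open>h\<close>, and \<open>f\<close> is supported
    where \<open>h\<close> is negative.\<close>
  have hf: "h \<otimes> f = (-1) \<odot> (k \<otimes> f)"
    by (simp add: f_def diff_scalar smult_mult_left smult_mult_right distrib_left distrib_right
        scalar_right_distrib k(2) hk add_comm)
  have rf: "self_adjoint (r \<otimes> f)" by (intro self_adjoint_mult positive_self_adjoint r f fr)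
  define c where "c = a \<otimes> f"
  have [simp]: "c \<in> carrier A" by (simp add: c_def)
  have "star A c \<otimes> c = f \<otimes> (h \<otimes> f)"
    using self_adjointD(2)[OF f] by (simp add: c_def h_def star_mult mult_assoc)
  also have "\<dots> = (-1) \<odot> (f \<otimes> r \<otimes> (r \<otimes> f))"
    unfolding hf unfolding r(2)[symmetric] by (simp add: smult_mult_left smult_mult_right mult_assoc)
  finally have cc: "star A c \<otimes> c = (-1) \<odot> (r \<otimes> f \<otimes> (r \<otimes> f))" unfolding fr .
  have "c = \<zero>"
    by (rule star_mult_neg_positive_eq_zero[OF _ positive_square[OF rf] cc]) simp
  then have "(-1) \<odot> (r \<otimes> f \<otimes> (r \<otimes> f)) = \<zero>" using cc by simp
  then have "(-1) \<odot> ((-1) \<odot> (r \<otimes> f \<otimes> (r \<otimes> f))) = \<zero>" by simp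
  then have "r \<otimes> f \<otimes> (r \<otimes> f) = \<zero>" by simp
  then have "r \<otimes> f = \<zero>" using square_eq_zeroD rf by blast
  then have "r \<otimes> (r \<otimes> f) = \<zero>" by simp
  then have kf: "k \<otimes> f = \<zero>" unfolding r(2)[symmetric] by (simp add: mult_assoc)
  have "f \<otimes> f = k \<otimes> f \<oplus> (-1) \<odot> (h \<otimes> f)"
    by (subst f_def, simp add: diff_scalar smult_mult_left distrib_right)
  also have "\<dots> = \<zero>" unfolding hf kf by simp
  finally have "f = \<zero>" using square_eq_zeroD f by blast
  then have "k = h" by (simp add: f_def diff_eq_zero_iff)
  then show ?thesis using k(1) by (simp add: h_def)
qed

text \<open>The second summand is a multiple of the unit minus the first, so the two commute and the
  norm is monotone on them.\<close>

lemma cnorm_star_mult_le: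
  assumes [simp]: "a \<in> carrier A" "b \<in> carrier A" and eq: "star A a \<otimes> a \<oplus> star A b \<otimes> b = c \<odot> \<one>"
  shows "cnorm A (star A a \<otimes> a) \<le> cmod c"
proof -
  have "star A b \<otimes> b = (star A a \<otimes> a \<oplus> star A b \<otimes> b) \<ominus> (star A a \<otimes> a)"
    by (simp add: diff_scalar add_comm[of "star A a \<otimes> a"] add_assoc collect)
  then have "star A b \<otimes> b = c \<odot> \<one> \<ominus> (star A a \<otimes> a)" unfolding eq .
  then have "(star A a \<otimes> a) \<otimes> (star A b \<otimes> b) = (star A b \<otimes> b) \<otimes> (star A a \<otimes> a)"
    by (simp add: diff_scalar smult_mult_left smult_mult_right distrib_left distrib_right)
  then have "cnorm A (star A a \<otimes> a) \<le> cnorm A (c \<odot> \<one>)"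
    using cnorm_mono_commuting[OF positive_star_mult positive_star_mult, of a b] eq by simp
  also have "\<dots> \<le> cmod c" using cnorm_one_le by (simp add: norm_smult mult_left_le)
  finally show ?thesis .
qed

section \<open>Norm bounds for positive unital maps\<close>

text \<open>Complete positivity read on 1-by-1 matrices. Having the form \<open>b* b\<close> on both
  sides makes the condition stable under composition.\<close>

definition positive_unital_map :: "('a \<Rightarrow> 'a) \<Rightarrow> bool" where
  "positive_unital_map T \<longleftrightarrow> linear_map A T \<and> T \<one> = \<one> \<and>
    (\<forall>a\<in>carrier A. \<exists>b\<in>carrier A. T (star A a \<otimes> a) = star A b \<otimes> b)"

lemma positive_unital_mapD:
  assumes "positive_unital_map T"
  shows "x \<in> carrier A \<Longrightarrow> T x \<in> carrier A" "T \<one> = \<one>"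
    "x \<in> carrier A \<Longrightarrow> y \<in> carrier A \<Longrightarrow> T (x \<oplus> y) = T x \<oplus> T y"
    "x \<in> carrier A \<Longrightarrow> T (c \<odot> x) = c \<odot> T x"
    "x \<in> carrier A \<Longrightarrow> y \<in> carrier A \<Longrightarrow> T (x \<ominus> y) = T x \<ominus> T y"
    "a \<in> carrier A \<Longrightarrow> \<exists>b\<in>carrier A. T (star A a \<otimes> a) = star A b \<otimes> b"
proof -
  show c: "x \<in> carrier A \<Longrightarrow> T x \<in> carrier A" for x
    using assms by (auto simp: positive_unital_map_def linear_map_def)
  show "x \<in> carrier A \<Longrightarrow> y \<in> carrier A \<Longrightarrow> T (x \<ominus> y) = T x \<ominus> T y"
    using c assms by (auto simp: positive_unital_map_def linear_map_def diff_scalar)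
qed (use assms in \<open>auto simp: positive_unital_map_def linear_map_def\<close>)

text \<open>Both \<open>1 - h\<close> and \<open>1 + h\<close> are squares of self-adjoint elements,
  so their images are of the form \<open>a* a\<close> and \<open>b* b\<close> and add up to
  \<open>2 1\<close>. Hence \<open>|T (1 - h)| <= 2\<close>, and \<open>T h = 1 - T (1 - h)\<close>
  gives the constant 3.\<close>

lemma cnorm_positive_map_unit_ball_le:
  assumes T: "positive_unital_map T" and h: "self_adjoint h" "cnorm A h \<le> 1"
  shows "cnorm A (T h) \<le> 3"
proof -
  note D = positive_unital_mapD[OF T]
  have hc [simp]: "h \<in> carrier A" using h self_adjointD by auto
  have *: "\<exists>b\<in>carrier A. T (\<one> \<ominus> g) = star A b \<otimes> b" if g: "self_adjoint g" "cnorm A g \<le> 1" for g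
  proof -
    obtain s where s: "self_adjoint s" "(\<one> \<ominus> s) \<otimes> (\<one> \<ominus> s) = \<one> \<ominus> g"
      using sqrt_one_minus[OF g] by metis
    have z: "\<one> \<ominus> s \<in> carrier A" "star A (\<one> \<ominus> s) = \<one> \<ominus> s"
      using self_adjoint_diff[OF self_adjoint_one s(1)] self_adjointD by blast+
    show ?thesis using D(6)[OF z(1)] unfolding z(2) s(2) .
  qed
  obtain a where a [simp]: "a \<in> carrier A" and Ta: "T (\<one> \<ominus> h) = star A a \<otimes> a"
    using *[OF h] by blast
  have "self_adjoint ((-1) \<odot> h)" "cnorm A ((-1) \<odot> h) \<le> 1"
    using self_adjoint_scalar[OF h(1), of "-1"] h by (auto simp: norm_smult)
  then obtain b where b [simp]: "b \<in> carrier A" and Tb: "T (\<one> \<ominus> (-1) \<odot> h) = star A b \<otimes> b"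
    using * by blast
  have sum: "(\<one> \<ominus> h) \<oplus> (\<one> \<ominus> (-1) \<odot> h) = 2 \<odot> \<one>"
    by (simp add: diff_scalar add_assoc add_comm[of _ h] add_left_comm[of "(-1) \<odot> h" \<one>] collect)
  have "T (\<one> \<ominus> h) \<oplus> T (\<one> \<ominus> (-1) \<odot> h) = 2 \<odot> \<one>"
    using D(3)[of "\<one> \<ominus> h" "\<one> \<ominus> (-1) \<odot> h"] D(4)[of \<one> 2] unfolding sum by (simp add: D(2))
  then have "cnorm A (star A a \<otimes> a) \<le> 2"
    using cnorm_star_mult_le[OF a b, of 2] by (simp add: Ta Tb)
  moreover have "h = \<one> \<ominus> (\<one> \<ominus> h)"
    by (simp add: diff_scalar scalar_right_distrib collect flip: add_assoc)
  then have "T h = \<one> \<ominus> star A a \<otimes> a" 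
    using D(5)[of \<one> "\<one> \<ominus> h"] by (simp add: D(2) Ta)
  then have "cnorm A (T h) \<le> cnorm A \<one> + cnorm A (star A a \<otimes> a)"
    using cnorm_diff_le by simp
  ultimately show ?thesis using cnorm_one_le by simp
qed

lemma cnorm_positive_map_self_adjoint_le:
  assumes T: "positive_unital_map T" and h: "self_adjoint h"
  shows "cnorm A (T h) \<le> 3 * cnorm A h"
proof -
  note D = positive_unital_mapD[OF T]
  have hc [simp]: "h \<in> carrier A" using h self_adjointD by auto
  show ?thesis
  proof (cases "cnorm A h = 0")
    case True
    then have "h = 0 \<odot> h" by (simp add: norm_eq_zero_iff)
    then have "T h = 0 \<odot> T h" using D(4)[of h 0] by simp
    then show ?thesis using True D(1) by simp
  next
    case False
    then have pos: "0 < cnorm A h" using norm_nonneg[of h] by simp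
    define g where "g = complex_of_real (1 / cnorm A h) \<odot> h"
    have "cnorm A (T g) \<le> 3"
      by (rule cnorm_positive_map_unit_ball_le[OF T])
        (use pos h in \<open>auto simp: g_def norm_smult norm_divide simp del: of_real_divide intro!: self_adjoint_scalar\<close>)
    moreover have "T g = complex_of_real (1 / cnorm A h) \<odot> T h" unfolding g_def by (rule D(4)) simp
    ultimately show ?thesis using pos D(1) by (simp add: norm_smult norm_divide field_simps)
  qed
qed

text \<open>Twice the self-adjoint constant 3: \<open>x = p - i q\<close> with self-adjoint
  \<open>p\<close> and \<open>q\<close> of norm at most \<open>|x|\<close>.\<close>

theorem cnorm_positive_map_le:
  assumes T: "positive_unital_map T" and x [simp]: "x \<in> carrier A"
  shows "cnorm A (T x) \<le> 6 * cnorm A x"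
proof -
  note D = positive_unital_mapD[OF T]
  define p q where "p = (1/2) \<odot> (x \<oplus> star A x)" and "q = (\<i>/2) \<odot> (x \<ominus> star A x)"
  have sa: "self_adjoint p" "self_adjoint q" 
    by (simp_all add: self_adjoint_def p_def q_def star_add star_smult diff_scalar scalar_right_distrib add_comm)
  then have [simp]: "p \<in> carrier A" "q \<in> carrier A" using self_adjointD by auto
  have "x = p \<oplus> (-\<i>) \<odot> q"
  proof -
    have "p \<oplus> (-\<i>) \<odot> q = ((1/2) \<odot> x \<oplus> (1/2) \<odot> x) \<oplus> ((1/2) \<odot> star A x \<oplus> (-1/2) \<odot> star A x)"
      by (simp add: p_def q_def scalar_right_distrib diff_scalar add_ac)
    also have "\<dots> = x" by (simp add: collect)
    finally show ?thesis by simp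
  qed
  then have "T x = T p \<oplus> (-\<i>) \<odot> T q" using D(3)[of p "(-\<i>) \<odot> q"] D(4)[of q "-\<i>"] by simp
  then have "cnorm A (T x) \<le> cnorm A (T p) + cnorm A (T q)"
    using norm_add[of "T p" "(-\<i>) \<odot> T q"] D(1) by (simp add: norm_smult)
  moreover have "cnorm A p \<le> cnorm A x"
    using norm_add[of x "star A x"] by (simp add: p_def norm_smult)
  moreover have "cnorm A q \<le> cnorm A x"
    using cnorm_diff_le[of x "star A x"] by (simp add: q_def norm_smult norm_divide)
  moreover have "cnorm A (T p) \<le> 3 * cnorm A p" "cnorm A (T q) \<le> 3 * cnorm A q"
    using cnorm_positive_map_self_adjoint_le[OF T] sa by auto
  ultimately show ?thesis by linarith
qed

lemma positive_unital_map_ucp: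
  assumes "ucp A T" shows "positive_unital_map T"
proof -
  have lin: "linear_map A T" and one: "T \<one> = \<one>" and
    pos: "\<And>M. positive_matrix A 1 M \<Longrightarrow> positive_matrix A 1 (\<lambda>i j. T (M i j))"
    using assms by (auto simp: ucp_def completely_positive_def)
  have "\<exists>b\<in>carrier A. T (star A a \<otimes> a) = star A b \<otimes> b" if a: "a \<in> carrier A" for a
  proof -
    have "positive_matrix A 1 (\<lambda>i j. star A a \<otimes> a)"
      unfolding positive_matrix_def using a by (intro exI[of _ "\<lambda>_ _. a"]) (simp add: lessThan_Suc)
    from pos[OF this] show ?thesis
      unfolding positive_matrix_def by (auto simp: lessThan_Suc)
  qed
  then show ?thesis using lin one by (simp add: positive_unital_map_def)
qed

text \<open>Iterates belong to the same class, so the constant 6 holds for all of them at once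
  instead of growing as a power.\<close>

lemma positive_unital_map_funpow:
  assumes "positive_unital_map T" shows "positive_unital_map (T ^^ k)"
proof (induction k)
  case 0
  show ?case by (auto simp: positive_unital_map_def linear_map_def)
next
  case (Suc k)
  have "\<exists>b\<in>carrier A. T ((T ^^ k) (star A a \<otimes> a)) = star A b \<otimes> b" if "a \<in> carrier A" for a
    using positive_unital_mapD(6)[OF Suc that] positive_unital_mapD(6)[OF assms] by metis
  then show ?case
    using positive_unital_mapD(1-4)[OF assms] positive_unital_mapD(1-4)[OF Suc]
    by (auto simp: positive_unital_map_def linear_map_def)
qed

section \<open>Norming functionals\<close>

text \<open>The value outside the carrier is fixed, so that the pointwise order is antisymmetric.\<close>

definition sublinear :: "('a \<Rightarrow> real) \<Rightarrow> bool" where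
  "sublinear p \<longleftrightarrow> (\<forall>x\<in>carrier A. \<forall>y\<in>carrier A. p (x \<oplus> y) \<le> p x + p y) \<and>
    (\<forall>c\<ge>0. \<forall>x\<in>carrier A. p (complex_of_real c \<odot> x) \<le> c * p x) \<and> (\<forall>x. x \<notin> carrier A \<longrightarrow> p x = 0)"

lemma sublinearD:
  assumes "sublinear p"
  shows "x \<in> carrier A \<Longrightarrow> y \<in> carrier A \<Longrightarrow> p (x \<oplus> y) \<le> p x + p y"
    "0 \<le> c \<Longrightarrow> x \<in> carrier A \<Longrightarrow> p (complex_of_real c \<odot> x) \<le> c * p x"
    "x \<notin> carrier A \<Longrightarrow> p x = 0"
    "p \<zero> = 0" "x \<in> carrier A \<Longrightarrow> 0 \<le> p x + p ((-1) \<odot> x)"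
    "0 \<le> c \<Longrightarrow> x \<in> carrier A \<Longrightarrow> c * p x \<le> p (complex_of_real c \<odot> x)"
proof -
  show add: "p (x \<oplus> y) \<le> p x + p y" if "x \<in> carrier A" "y \<in> carrier A" for x y
    using assms that by (simp add: sublinear_def)
  show scl: "p (complex_of_real c \<odot> x) \<le> c * p x" if "0 \<le> c" "x \<in> carrier A" for c x
    using assms that by (simp add: sublinear_def)
  show "x \<notin> carrier A \<Longrightarrow> p x = 0" using assms by (simp add: sublinear_def)
  show zero: "p \<zero> = 0" using add[of \<zero> \<zero>] scl[of 0 \<zero>] by simp
  show "0 \<le> p x + p ((-1) \<odot> x)" if "x \<in> carrier A" for x
    using add[of x "(-1) \<odot> x"] zero that by (simp add: collect)
  show "c * p x \<le> p (complex_of_real c \<odot> x)" if "0 \<le> c" "x \<in> carrier A" for c x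
  proof (cases "c = 0")
    case False
    then show ?thesis using scl[of "1 / c" "complex_of_real c \<odot> x"] that by (simp add: field_simps)
  qed (use zero that in simp)
qed

text \<open>The Hahn-Banach auxiliary function, the infimum over \<open>t >= 0\<close> of
  \<open>p (x + t y) - t p y\<close>. The choice \<open>t = 0\<close> gives \<open>q <= p\<close>
  and \<open>t = 1\<close> the last claim. If \<open>p\<close> is minimal, then
  \<open>q = p\<close>, and that claim becomes superadditivity.\<close>

lemma sublinear_reduce:
  assumes p: "sublinear p" and y [simp]: "y \<in> carrier A"
  shows "\<exists>q. sublinear q \<and> q \<le> p \<and> (\<forall>x\<in>carrier A. q x \<le> p (x \<oplus> y) - p y)"
proof -
  note D = sublinearD[OF p]
  define g where "g t x = p (x \<oplus> complex_of_real t \<odot> y) - t * p y" for t x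
  define q where "q x = (if x \<in> carrier A then INF t\<in>{0..}. g t x else 0)" for x
  \<comment> \<open>Keeps the infimum finite: \<open>t p y <= p (t y)\<close>, and
    \<open>t y\<close> is the sum of \<open>x + t y\<close> and \<open>- x\<close>.\<close>
  have lower: "- p ((-1) \<odot> x) \<le> g t x" if [simp]: "x \<in> carrier A" and t: "0 \<le> t" for t x
  proof -
    have "complex_of_real t \<odot> y = (x \<oplus> complex_of_real t \<odot> y) \<oplus> (-1) \<odot> x"
      by (simp add: add_comm[of x] add_assoc collect)
    then have "p (complex_of_real t \<odot> y) \<le> p (x \<oplus> complex_of_real t \<odot> y) + p ((-1) \<odot> x)"
      using D(1)[of "x \<oplus> complex_of_real t \<odot> y" "(-1) \<odot> x"] by simp
    then show ?thesis using D(6)[OF t y] by (simp add: g_def)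
  qed
  have le: "q x \<le> g t x" if "x \<in> carrier A" "0 \<le> t" for t x
    unfolding q_def using that lower by (auto intro!: cINF_lower bdd_belowI2)
  have ge: "b \<le> q x" if "x \<in> carrier A" "\<And>t. 0 \<le> t \<Longrightarrow> b \<le> g t x" for b x
    unfolding q_def using that by (auto intro!: cINF_greatest)
  have "sublinear q"
    unfolding sublinear_def
  proof (intro conjI ballI allI impI)
    fix x x' assume [simp]: "x \<in> carrier A" "x' \<in> carrier A"
    have "q (x \<oplus> x') - g t x' \<le> g s x" if "0 \<le> s" "0 \<le> t" for s t
    proof -
      have "(x \<oplus> x') \<oplus> complex_of_real (s + t) \<odot> y = (x \<oplus> complex_of_real s \<odot> y) \<oplus> (x' \<oplus> complex_of_real t \<odot> y)"
        by (simp add: scalar_left_distrib add_ac)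
      then have "g (s + t) (x \<oplus> x') \<le> g s x + g t x'"
        using D(1)[of "x \<oplus> complex_of_real s \<odot> y" "x' \<oplus> complex_of_real t \<odot> y"] by (simp add: g_def algebra_simps)
      then show ?thesis using le[of "x \<oplus> x'" "s + t"] that by simp
    qed
    then have "q (x \<oplus> x') - g t x' \<le> q x" if "0 \<le> t" for t
      using that by (intro ge) auto
    then have "q (x \<oplus> x') - q x \<le> q x'" by (intro ge) (auto simp: algebra_simps)
    then show "q (x \<oplus> x') \<le> q x + q x'" by simp
  next
    fix c :: real and x assume c: "0 \<le> c" and [simp]: "x \<in> carrier A"
    have *: "q (complex_of_real c \<odot> x) \<le> c * g t x" if t: "0 \<le> t" for t
    proof -
      have "complex_of_real c \<odot> x \<oplus> complex_of_real (c * t) \<odot> y = complex_of_real c \<odot> (x \<oplus> complex_of_real t \<odot> y)"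
        by (simp add: scalar_right_distrib)
      then have "g (c * t) (complex_of_real c \<odot> x) \<le> c * g t x"
        using D(2)[OF c, of "x \<oplus> complex_of_real t \<odot> y"] by (simp add: g_def algebra_simps)
      then show ?thesis using le[of "complex_of_real c \<odot> x" "c * t"] c t by simp
    qed
    show "q (complex_of_real c \<odot> x) \<le> c * q x"
    proof (cases "c = 0")
      case True then show ?thesis using *[of 0] by simp
    next
      case False
      then have "q (complex_of_real c \<odot> x) / c \<le> q x"
        using * c by (intro ge) (auto simp: field_simps)
      then show ?thesis using False c by (simp add: field_simps)
    qed
  qed (simp add: q_def)
  moreover have "q x \<le> p x" for x
    using le[of x 0] D(3)[of x] by (cases "x \<in> carrier A") (auto simp: g_def q_def)
  moreover have "\<forall>x\<in>carrier A. q x \<le> p (x \<oplus> y) - p y"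
    using le[of _ 1] by (auto simp: g_def)
  ultimately show ?thesis by (auto simp: le_fun_def)
qed

text \<open>The pointwise infimum works: it is finite because \<open>p <= p0\<close> yields
  \<open>p x >= - p0 (- x)\<close>, and it is subadditive because of two members \<open>p\<close>
  and \<open>q\<close> the smaller one bounds the infimum at \<open>x + y\<close> by
  \<open>p x + q y\<close>.\<close>

lemma sublinear_chain_lower_bound:
  assumes C: "C \<noteq> {}" "\<And>p. p \<in> C \<Longrightarrow> sublinear p \<and> p \<le> p0"
    and chain: "\<And>p q. p \<in> C \<Longrightarrow> q \<in> C \<Longrightarrow> p \<le> q \<or> q \<le> p"
  shows "\<exists>u. sublinear u \<and> u \<le> p0 \<and> (\<forall>p\<in>C. u \<le> p)"
proof -
  define u where "u x = (INF p\<in>C. p x)" for x :: 'a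
  have lower: "- p0 ((-1) \<odot> x) \<le> p x" if "p \<in> C" "x \<in> carrier A" for p x
    using sublinearD(5)[of p x] C(2)[OF that(1)] that(2) le_funD[of p p0 "(-1) \<odot> x"] by auto
  have img: "(\<lambda>p. p x) ` C = {0}" if "x \<notin> carrier A" for x
  proof -
    have "p x = 0" if "p \<in> C" for p using sublinearD(3) C(2)[OF that] \<open>x \<notin> carrier A\<close> by blast
    then show ?thesis using C(1) by force
  qed
  have le: "u x \<le> p x" if p: "p \<in> C" for p x
  proof (cases "x \<in> carrier A")
    case True
    then show ?thesis unfolding u_def using lower p by (auto intro!: cINF_lower bdd_belowI2)
  next
    case False
    then show ?thesis using sublinearD(3)[of p x] C(2)[OF p] img by (simp add: u_def)
  qed
  have ge: "b \<le> u x" if "\<And>p. p \<in> C \<Longrightarrow> b \<le> p x" for b x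
    unfolding u_def using that C(1) by (auto intro!: cINF_greatest)
  have "sublinear u"
    unfolding sublinear_def
  proof (intro conjI ballI allI impI)
    fix x y assume xy: "x \<in> carrier A" "y \<in> carrier A"
    have "u (x \<oplus> y) - q y \<le> p x" if pq: "p \<in> C" "q \<in> C" for p q
    proof -
      obtain r where r: "r \<in> C" "r \<le> p" "r \<le> q" using chain[OF pq] pq by auto
      have "u (x \<oplus> y) \<le> r x + r y"
        using le[OF r(1), of "x \<oplus> y"] sublinearD(1)[of r x y] C(2)[OF r(1)] xy by auto
      then show ?thesis using le_funD[OF r(2), of x] le_funD[OF r(3), of y] by simp
    qed
    then have "u (x \<oplus> y) - q y \<le> u x" if "q \<in> C" for q using that by (intro ge) auto
    then have "u (x \<oplus> y) - u x \<le> u y" by (intro ge) (auto simp: algebra_simps)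
    then show "u (x \<oplus> y) \<le> u x + u y" by simp
  next
    fix c :: real and x assume c: "0 \<le> c" and x: "x \<in> carrier A"
    have *: "u (complex_of_real c \<odot> x) \<le> c * p x" if "p \<in> C" for p
      using le[OF that, of "complex_of_real c \<odot> x"] sublinearD(2)[of p c x] C(2)[OF that] c x by auto
    show "u (complex_of_real c \<odot> x) \<le> c * u x"
    proof (cases "c = 0")
      case True then show ?thesis using * C(1) by fastforce
    next
      case False
      then have "u (complex_of_real c \<odot> x) / c \<le> u x"
        using * c by (intro ge) (auto simp: field_simps)
      then show ?thesis using False c by (simp add: field_simps)
    qed
  next
    fix x assume "x \<notin> carrier A"
    then show "u x = 0" using img by (simp add: u_def)
  qed
  moreover have "u \<le> p0" using le C order_trans unfolding le_fun_def by blast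
  ultimately show ?thesis using le by (auto simp: le_fun_def)
qed

text \<open>Zorn's lemma for the reversed pointwise order; the empty chain is bounded by
  \<open>p0\<close> itself.\<close>

lemma minimal_sublinear_exists:
  assumes p0: "sublinear p0"
  shows "\<exists>p. sublinear p \<and> p \<le> p0 \<and> (\<forall>q. sublinear q \<longrightarrow> q \<le> p \<longrightarrow> q = p)"
proof -
  let ?S = "{p. sublinear p \<and> p \<le> p0}" and ?R = "\<lambda>p q :: 'a \<Rightarrow> real. q \<le> p"
  have "\<exists>m\<in>?S. \<forall>a\<in>?S. ?R m a \<longrightarrow> a = m"
  proof (rule predicate_Zorn)
    show "partial_order_on ?S (relation_of ?R ?S)"
      by (rule partial_order_on_relation_ofI) auto
    fix C assume C: "C \<in> Chains (relation_of ?R ?S)"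
    show "\<exists>u\<in>?S. \<forall>a\<in>C. u \<le> a"
    proof (cases "C = {}")
      case True then show ?thesis using p0 by auto
    next
      case False
      have "\<exists>u. sublinear u \<and> u \<le> p0 \<and> (\<forall>p\<in>C. u \<le> p)"
        by (rule sublinear_chain_lower_bound[OF False])
           (use C in \<open>auto simp: Chains_def relation_of_def\<close>)
      then show ?thesis by auto
    qed
  qed
  then show ?thesis using order_trans by blast
qed

text \<open>A minimal sublinear function is additive, and the complexification of a real-linear
  functional bounded by the norm is bounded by twice the norm.\<close>

theorem norming_functional:
  assumes y [simp]: "y \<in> carrier A"
  shows "\<exists>\<psi>. linear_functional A \<psi> \<and> (\<forall>x\<in>carrier A. cmod (\<psi> x) \<le> 2 * cnorm A x) \<and>
    cnorm A y \<le> cmod (\<psi> y)"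
proof -
  define N where "N x = (if x \<in> carrier A then cnorm A x else 0)" for x
  have "sublinear N" by (auto simp: sublinear_def N_def norm_add norm_smult)
  \<comment> \<open>Reducing the norm at \<open>y\<close> before minimizing fixes the value there:
    at \<open>- y\<close> the reduced function is at most \<open>- |y|\<close>, so every additive
    function below it is at least \<open>|y|\<close> at \<open>y\<close>.\<close>
  from sublinear_reduce[OF this y] obtain p0 where p0: "sublinear p0" "p0 \<le> N"
    "\<And>x. x \<in> carrier A \<Longrightarrow> p0 x \<le> N (x \<oplus> y) - N y" by blast
  from minimal_sublinear_exists[OF p0(1)] obtain p where p: "sublinear p" "p \<le> p0"
    and min: "\<And>q. sublinear q \<Longrightarrow> q \<le> p \<Longrightarrow> q = p" by blast
  note D = sublinearD[OF p(1)]
  have add: "p (x \<oplus> z) = p x + p z" if xz: "x \<in> carrier A" "z \<in> carrier A" for x z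
  proof (rule antisym)
    obtain q where q: "sublinear q" "q \<le> p" "\<forall>x\<in>carrier A. q x \<le> p (x \<oplus> z) - p z"
      using sublinear_reduce[OF p(1) xz(2)] by blast
    then show "p x + p z \<le> p (x \<oplus> z)" using min[of q] xz by force
  qed (use D xz in auto)
  have neg: "p ((-1) \<odot> x) = - p x" if "x \<in> carrier A" for x
    using add[of x "(-1) \<odot> x"] D(4) that by (simp add: collect)
  have pos_scl: "p (complex_of_real c \<odot> x) = c * p x" if "0 \<le> c" "x \<in> carrier A" for c x
    using D(2,6)[OF that] by simp
  have scl: "p (complex_of_real c \<odot> x) = c * p x" if "x \<in> carrier A" for c x
  proof (cases "0 \<le> c")
    case False
    then show ?thesis
      using pos_scl[of "-c" x] neg[of "complex_of_real (-c) \<odot> x"] that by simp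
  qed (use pos_scl that in auto)
  have bound: "\<bar>p x\<bar> \<le> cnorm A x" if "x \<in> carrier A" for x
  proof -
    have "p x \<le> cnorm A x" if "x \<in> carrier A" for x
      using le_funD[OF p(2), of x] le_funD[OF p0(2), of x] that by (simp add: N_def)
    from this[of x] this[of "(-1) \<odot> x"] show ?thesis
      using neg that by (auto simp: norm_smult abs_le_iff)
  qed
  \<comment> \<open>The usual complexification \<open>p x - i p (i x)\<close> of a real-linear
    functional.\<close>
  define \<psi> where "\<psi> x = Complex (p x) (- p (\<i> \<odot> x))" for x
  have "linear_functional A \<psi>"
    unfolding linear_functional_def
  proof (intro conjI ballI allI)
    fix x z assume "x \<in> carrier A" "z \<in> carrier A"
    then show "\<psi> (x \<oplus> z) = \<psi> x + \<psi> z"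
      by (simp add: \<psi>_def add scalar_right_distrib complex_eq_iff)
  next
    fix c x assume [simp]: "x \<in> carrier A"
    have dec: "p (d \<odot> x) = Re d * p x + Im d * p (\<i> \<odot> x)" for d
    proof -
      have "d \<odot> x = complex_of_real (Re d) \<odot> x \<oplus> complex_of_real (Im d) \<odot> (\<i> \<odot> x)"
        using scalar_left_distrib[of x "complex_of_real (Re d)" "complex_of_real (Im d) * \<i>"] complex_eq[of d]
        by (simp add: mult.commute)
      then show ?thesis using scl[of x] scl[of "\<i> \<odot> x"] add by simp
    qed
    show "\<psi> (c \<odot> x) = c * \<psi> x"
      using dec[of c] dec[of "\<i> * c"] by (simp add: \<psi>_def complex_eq_iff)
  qed
  moreover have "cmod (\<psi> x) \<le> 2 * cnorm A x" if "x \<in> carrier A" for x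
    using cmod_le[of "\<psi> x"] bound[of x] bound[of "\<i> \<odot> x"] that by (simp add: \<psi>_def norm_smult)
  moreover have "cnorm A y \<le> cmod (\<psi> y)"
  proof -
    have "p ((-1) \<odot> y) \<le> - cnorm A y"
      using p0(3)[of "(-1) \<odot> y"] le_funD[OF p(2), of "(-1) \<odot> y"] by (simp add: collect N_def)
    then have "cnorm A y \<le> Re (\<psi> y)" using neg by (simp add: \<psi>_def)
    then show ?thesis using complex_Re_le_cmod[of "\<psi> y"] by simp
  qed
  ultimately show ?thesis by blast
qed

section \<open>Ergodic averages\<close>

lemma linear_functionalD:
  assumes "linear_functional A \<psi>"
  shows "x \<in> carrier A \<Longrightarrow> y \<in> carrier A \<Longrightarrow> \<psi> (x \<oplus> y) = \<psi> x + \<psi> y"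
    "x \<in> carrier A \<Longrightarrow> \<psi> (c \<odot> x) = c * \<psi> x"
    "x \<in> carrier A \<Longrightarrow> y \<in> carrier A \<Longrightarrow> \<psi> (x \<ominus> y) = \<psi> x - \<psi> y"
  using assms by (auto simp: linear_functional_def diff_scalar)

lemma finsum_lessThan_closed [simp]: "(\<And>k. k < n \<Longrightarrow> f k \<in> carrier A) \<Longrightarrow> (\<Oplus>\<^bsub>A\<^esub>k\<in>{..<n}. f k) \<in> carrier A"
  by (rule abelian_monoid.finsum_closed[OF abelian_group.axioms(1)[OF ring.is_abelian_group[OF is_ring]]]) auto

lemma finsum_lessThan_Suc:
  assumes "\<And>k. k \<le> n \<Longrightarrow> f k \<in> carrier A"
  shows "(\<Oplus>\<^bsub>A\<^esub>k\<in>{..<Suc n}. f k) = f n \<oplus> (\<Oplus>\<^bsub>A\<^esub>k\<in>{..<n}. f k)"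
  unfolding lessThan_Suc
  using assms
  by (intro abelian_monoid.finsum_insert[OF abelian_group.axioms(1)[OF ring.is_abelian_group[OF is_ring]]]) auto

lemma linear_functional_weighted_average:
  assumes "linear_functional A \<psi>" "\<And>k. (T ^^ k) x \<in> carrier A"
  shows "\<psi> (weighted_average A b T x n) = 1 / of_nat n * (\<Sum>k<n. b k * \<psi> ((T ^^ k) x))"
proof -
  note D = linear_functionalD[OF assms(1)]
  have "\<psi> (\<Oplus>\<^bsub>A\<^esub>k\<in>{..<n}. b k \<odot> (T ^^ k) x) = (\<Sum>k<n. b k * \<psi> ((T ^^ k) x))"
  proof (induction n)
    case 0
    show ?case using D(2)[of \<zero> 0] by simp
  next
    case (Suc n)
    then show ?case using assms(2) by (subst finsum_lessThan_Suc) (auto simp: D)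
  qed
  then show ?thesis using assms(2) by (simp add: weighted_average_def D)
qed

lemma weighted_average_closed:
  "(\<And>k. (T ^^ k) x \<in> carrier A) \<Longrightarrow> weighted_average A b T x n \<in> carrier A"
  by (simp add: weighted_average_def)

text \<open>The norming functional varies with \<open>n\<close>, which is why the Cesaro limit must
  be uniform over \<open>B\<close>. Once it is, the weights are replaced by their bound
  \<open>\<beta>\<close> inside the sum.\<close>

theorem weighted_average_norm_null:
  assumes T: "positive_unital_map T" and x: "x \<in> carrier A"
    and weak: "\<And>\<psi>. in_dual A \<psi> \<Longrightarrow> (\<lambda>n. 1 / real n * (\<Sum>k<n. cmod (\<psi> ((T ^^ k) x)))) \<longlonglongrightarrow> 0"
    and b: "\<And>k. cmod (b k) \<le> \<beta>" and \<beta>: "0 < \<beta>"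
  shows "(\<lambda>n. cnorm A (weighted_average A b T x n)) \<longlonglongrightarrow> 0"
proof -
  have Tk: "(T ^^ k) y \<in> carrier A" "cnorm A ((T ^^ k) y) \<le> 6 * cnorm A y" if "y \<in> carrier A" for k y
    using positive_unital_mapD(1)[OF positive_unital_map_funpow[OF T] that]
      cnorm_positive_map_le[OF positive_unital_map_funpow[OF T] that] by auto
  \<comment> \<open>The last set makes \<open>B\<close> invariant under composition with
    \<open>T\<close>. With \<open>12 = 2 * 6\<close> it admits every functional bounded by twice the
    norm, after this is set to 0 off the carrier. That default value bounds the box in every
    coordinate.\<close>
  define B where "B = {\<psi>. \<forall>y. cmod (\<psi> y) \<le> (if y \<in> carrier A then 12 * cnorm A y else 0)} \<inter>
    {\<psi>. \<forall>y\<in>carrier A. \<forall>z\<in>carrier A. \<psi> (y \<oplus> z) = \<psi> y + \<psi> z} \<inter>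
    {\<psi>. \<forall>c. \<forall>y\<in>carrier A. \<psi> (c \<odot> y) = c * \<psi> y} \<inter>
    {\<psi>. \<forall>k. \<forall>y\<in>carrier A. cmod (\<psi> ((T ^^ k) y)) \<le> 12 * cnorm A y}"
  have "compact B"
    unfolding B_def Int_assoc
    by (intro compact_Int_closed compact_box closed_Int closed_Collect_all)
       (simp_all only: Ball_def, (intro closed_Collect_all closed_Collect_imp open_Collect_const
         closed_Collect_eq closed_Collect_le continuous_intros continuous_on_coordinate)+)
  moreover have "continuous_on B (\<lambda>\<psi>. cmod (\<psi> ((T ^^ k) x)))" for k
    by (intro continuous_intros continuous_on_coordinate)
  moreover have "\<exists>\<psi>'\<in>B. \<forall>k. cmod (\<psi>' ((T ^^ k) x)) = cmod (\<psi> ((T ^^ Suc k) x))" if \<psi>: "\<psi> \<in> B" for \<psi>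
  proof (intro bexI[of _ "\<lambda>y. if y \<in> carrier A then \<psi> (T y) else 0"] allI)
    show "(\<lambda>y. if y \<in> carrier A then \<psi> (T y) else 0) \<in> B"
    proof -
      \<comment> \<open>The orbit bound of \<open>\<psi>\<close> at power 1 gives the box bound of
        the shifted functional, and at \<open>Suc k\<close> its orbit bound.\<close>
      have "cmod (\<psi> (T y)) \<le> 12 * cnorm A y" if "y \<in> carrier A" for y
        using \<psi> that by (auto simp: B_def dest!: spec[of _ 1])
      moreover have "cmod (\<psi> (T ((T ^^ k) y))) \<le> 12 * cnorm A y" if "y \<in> carrier A" for y k
        using \<psi> that unfolding B_def by (auto dest!: spec[of _ "Suc k"])
      ultimately show ?thesis
        using \<psi> Tk(1) positive_unital_mapD(1,3,4)[OF T] by (auto simp: B_def)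
    qed
    show "cmod (if (T ^^ k) x \<in> carrier A then \<psi> (T ((T ^^ k) x)) else 0) = cmod (\<psi> ((T ^^ Suc k) x))" for k
      using Tk(1)[OF x] by simp
  qed
  moreover have "cmod (\<psi> ((T ^^ k) x)) \<le> 12 * cnorm A x" if "\<psi> \<in> B" for \<psi> k
    using that x by (auto simp: B_def)
  moreover have "0 \<le> 12 * cnorm A x" using x norm_nonneg by simp
  moreover have "in_dual A \<psi>" if "\<psi> \<in> B" for \<psi>
    using that by (auto simp: B_def in_dual_def linear_functional_def split: if_splits intro!: exI[of _ 12])
  then have "(\<lambda>n. 1 / real n * (\<Sum>k<n. cmod (\<psi> ((T ^^ k) x)))) \<longlonglongrightarrow> 0" if "\<psi> \<in> B" for \<psi>
    using weak that by blast
  ultimately have unif: "\<exists>N. \<forall>n\<ge>N. \<forall>\<psi>\<in>B. 1 / real n * (\<Sum>k<n. cmod (\<psi> ((T ^^ k) x))) \<le> \<epsilon>" if "0 < \<epsilon>" for \<epsilon>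
    using that by (rule cesaro_null_uniform)
  show ?thesis
  proof (rule LIMSEQ_I)
    fix \<epsilon> :: real assume \<epsilon>: "0 < \<epsilon>"
    then obtain N where N: "\<forall>n\<ge>N. \<forall>\<psi>\<in>B. 1 / real n * (\<Sum>k<n. cmod (\<psi> ((T ^^ k) x))) \<le> \<epsilon> / (2 * \<beta>)"
      using unif[of "\<epsilon> / (2 * \<beta>)"] \<beta> by auto
    have "cnorm A (weighted_average A b T x n) \<le> \<epsilon> / 2" if n: "N \<le> n" for n
    proof -
      have w: "weighted_average A b T x n \<in> carrier A" by (rule weighted_average_closed[OF Tk(1)[OF x]])
      then obtain \<psi>0 where \<psi>0: "linear_functional A \<psi>0" "\<forall>y\<in>carrier A. cmod (\<psi>0 y) \<le> 2 * cnorm A y"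
        "cnorm A (weighted_average A b T x n) \<le> cmod (\<psi>0 (weighted_average A b T x n))"
        using norming_functional by blast
      \<comment> \<open>The norming functional is unconstrained off the carrier, whereas the box
        requires the value 0 there.\<close>
      define \<psi> where "\<psi> y = (if y \<in> carrier A then \<psi>0 y else 0)" for y
      have lin: "linear_functional A \<psi>" using \<psi>0(1) by (auto simp: \<psi>_def linear_functional_def)
      have "cmod (\<psi>0 y) \<le> 12 * cnorm A y" if "y \<in> carrier A" for y
        using \<psi>0(2) norm_nonneg[OF that] that by fastforce
      moreover have "cmod (\<psi>0 ((T ^^ k) y)) \<le> 12 * cnorm A y" if "y \<in> carrier A" for y k
        using \<psi>0(2) Tk[OF that, of k] by fastforce
      ultimately have "\<psi> \<in> B"
        using lin Tk(1) unfolding B_def linear_functional_def by (auto simp: \<psi>_def)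
      have "cnorm A (weighted_average A b T x n) \<le> cmod (1 / of_nat n * (\<Sum>k<n. b k * \<psi> ((T ^^ k) x)))"
        unfolding linear_functional_weighted_average[OF lin Tk(1)[OF x], symmetric]
        using \<psi>0(3) w by (simp add: \<psi>_def)
      also have "\<dots> = 1 / real n * cmod (\<Sum>k<n. b k * \<psi> ((T ^^ k) x))"
        by (simp add: Real_Vector_Spaces.norm_mult norm_divide)
      also have "\<dots> \<le> 1 / real n * (\<Sum>k<n. \<beta> * cmod (\<psi> ((T ^^ k) x)))"
      proof (intro mult_left_mono sum_norm_le)
        show "cmod (b k * \<psi> ((T ^^ k) x)) \<le> \<beta> * cmod (\<psi> ((T ^^ k) x))" for k
          unfolding Real_Vector_Spaces.norm_mult by (intro mult_right_mono b norm_ge_zero)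
      qed simp
      also have "\<dots> = \<beta> * (1 / real n * (\<Sum>k<n. cmod (\<psi> ((T ^^ k) x))))"
        by (simp add: sum_distrib_left)
      also have "\<dots> \<le> \<beta> * (\<epsilon> / (2 * \<beta>))"
        using N n \<open>\<psi> \<in> B\<close> \<beta> by (intro mult_left_mono) auto
      finally show ?thesis using \<beta> by simp
    qed
    moreover have "0 \<le> cnorm A (weighted_average A b T x n)" for n
      by (intro norm_nonneg weighted_average_closed Tk(1)[OF x])
    ultimately have "norm (cnorm A (weighted_average A b T x n) - 0) < \<epsilon>" if "N \<le> n" for n
      using that \<epsilon> by (fastforce intro: le_less_trans)
    then show "\<exists>no. \<forall>n\<ge>no. norm (cnorm A (weighted_average A b T x n) - 0) < \<epsilon>" by blast
  qed
qed
text \<open>Otherwise a cluster point of the averages would be an invariant state other than \<open>\<nu>\<close>.\<close>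

theorem uniquely_ergodic_average:
  assumes ue: "uniquely_ergodic A \<nu> T" and \<omega>: "state A \<omega>"
    and bd: "\<And>y. y \<in> carrier A \<Longrightarrow> cmod (\<omega> y) \<le> C * cnorm A y" and C: "0 \<le> C"
    and x: "x \<in> carrier A"
  shows "(\<lambda>n. 1 / of_nat n * (\<Sum>k<n. \<omega> ((T ^^ k) x))) \<longlonglongrightarrow> \<nu> x"
proof (rule ccontr)
  have T: "positive_unital_map T"
    using ue by (auto simp: uniquely_ergodic_def state_preserving_system_def intro: positive_unital_map_ucp)
  note Tk = positive_unital_mapD[OF positive_unital_map_funpow[OF T]]
  have lin: "linear_functional A \<omega>" and \<omega>_pos: "\<And>y. y \<in> carrier A \<Longrightarrow> \<omega> (star A y \<otimes> y) \<in> \<real>\<^sub>\<ge>\<^sub>0"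
    and \<omega>_one: "\<omega> \<one> = 1"
    using \<omega> by (auto simp: state_def)
  have \<omega>T: "cmod (\<omega> ((T ^^ k) y)) \<le> 6 * C * cnorm A y" if y: "y \<in> carrier A" for k y
  proof -
    have "cmod (\<omega> ((T ^^ k) y)) \<le> C * cnorm A ((T ^^ k) y)" by (rule bd[OF Tk(1)[OF y]])
    also have "\<dots> \<le> C * (6 * cnorm A y)"
      by (intro mult_left_mono C cnorm_positive_map_le[OF positive_unital_map_funpow[OF T] y])
    finally show ?thesis by (simp add: algebra_simps)
  qed
  \<comment> \<open>The averages of the states \<open>\<omega>\<close> composed with
    \<open>T^k\<close>, set to 0 off the carrier so that all of them lie in one compact box.\<close>
  define \<psi> where "\<psi> n y = (if y \<in> carrier A then 1 / of_nat n * (\<Sum>k<n. \<omega> ((T ^^ k) y)) else 0)" for n y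
  assume "\<not> (\<lambda>n. 1 / of_nat n * (\<Sum>k<n. \<omega> ((T ^^ k) x))) \<longlonglongrightarrow> \<nu> x"
  then have "\<not> (\<lambda>n. \<psi> n x) \<longlonglongrightarrow> \<nu> x" using x by (simp add: \<psi>_def)
  then obtain \<epsilon> where \<epsilon>: "0 < \<epsilon>" "\<not> eventually (\<lambda>n. dist (\<psi> n x) (\<nu> x) < \<epsilon>) sequentially"
    unfolding tendsto_iff by blast
  \<comment> \<open>Tails restricted to the indices whose average stays at distance at least
    \<open>\<epsilon>\<close> from \<open>\<nu> x\<close>; failure of convergence makes this filter
    proper.\<close>
  define F where "F = inf sequentially (principal {n. \<not> dist (\<psi> n x) (\<nu> x) < \<epsilon>})"
  have F: "F \<noteq> bot"
    using \<epsilon>(2) unfolding F_def trivial_limit_def eventually_inf_principal by simp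
  define B where "B = {f. \<forall>y. cmod (f y) \<le> (if y \<in> carrier A then 6 * C * cnorm A y else 0)}"
  have B: "compact B" unfolding B_def by (rule compact_box)
  have in_B: "\<psi> n \<in> B" for n
  proof -
    have "cmod (\<psi> n y) \<le> 6 * C * cnorm A y" if y: "y \<in> carrier A" for y
    proof -
      have "cmod (\<psi> n y) = 1 / real n * cmod (\<Sum>k<n. \<omega> ((T ^^ k) y))"
        using y by (simp add: \<psi>_def Real_Vector_Spaces.norm_mult norm_divide)
      also have "\<dots> \<le> 1 / real n * (real n * (6 * C * cnorm A y))"
        by (intro mult_left_mono order_trans[OF sum_norm_le[OF \<omega>T[OF y]]]) simp_all
      also have "\<dots> \<le> 6 * C * cnorm A y" using C norm_nonneg[OF y] by simp
      finally show ?thesis .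
    qed
    then show ?thesis by (simp add: \<psi>_def B_def)
  qed
  obtain l G where "G \<le> F" and G: "G \<noteq> bot" and l: "(\<psi> \<longlongrightarrow> l) G"
    by (rule cluster_filter_compact[OF B F always_eventually[OF allI[OF in_B]]])
  have G_seq: "G \<le> sequentially" and G_far: "eventually (\<lambda>n. \<not> dist (\<psi> n x) (\<nu> x) < \<epsilon>) G"
    using \<open>G \<le> F\<close> by (auto simp: F_def le_principal)
  have lim: "((\<lambda>n. \<psi> n y) \<longlongrightarrow> l y) G" for y
    by (rule tendsto_coordinate[OF l])
  \<comment> \<open>At \<open>n = 0\<close> the average is 0 by the convention for division and so
    is not unital.\<close>
  have ev1: "eventually (\<lambda>n. 1 \<le> n) G"
    by (rule filter_leD[OF G_seq eventually_ge_at_top])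
  have "state A l"
    unfolding state_def linear_functional_def
  proof (intro conjI ballI allI)
    fix y z assume y: "y \<in> carrier A" and z: "z \<in> carrier A"
    have "\<psi> n (y \<oplus> z) = \<psi> n y + \<psi> n z" for n
      using y z Tk(1,3) linear_functionalD(1)[OF lin] by (simp add: \<psi>_def sum.distrib algebra_simps add_divide_distrib)
    then have "((\<lambda>n. \<psi> n (y \<oplus> z)) \<longlongrightarrow> l y + l z) G"
      using tendsto_add[OF lim[of y] lim[of z]] by simp
    with lim show "l (y \<oplus> z) = l y + l z" by (rule tendsto_unique[OF G])
  next
    fix c y assume y: "y \<in> carrier A"
    have "\<psi> n (c \<odot> y) = c * \<psi> n y" for n
      using y Tk(1,4) linear_functionalD(2)[OF lin] by (simp add: \<psi>_def sum_distrib_left)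
    then have "((\<lambda>n. \<psi> n (c \<odot> y)) \<longlongrightarrow> c * l y) G"
      using tendsto_mult_left[OF lim[of y], of c] by simp
    with lim show "l (c \<odot> y) = c * l y" by (rule tendsto_unique[OF G])
  next
    fix y assume y: "y \<in> carrier A"
    have "\<omega> ((T ^^ k) (star A y \<otimes> y)) \<in> \<real>\<^sub>\<ge>\<^sub>0" for k
    proof -
      obtain c where "c \<in> carrier A" "(T ^^ k) (star A y \<otimes> y) = star A c \<otimes> c"
        using Tk(6)[OF y, of k] by blast
      then show ?thesis using \<omega>_pos[of c] by simp
    qed
    then have "\<psi> n (star A y \<otimes> y) \<in> \<real>\<^sub>\<ge>\<^sub>0" for n
      by (auto simp: \<psi>_def complex_nonneg_Reals_iff sum_nonneg)
    then show "l (star A y \<otimes> y) \<in> \<real>\<^sub>\<ge>\<^sub>0"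
      by (intro Lim_in_closed_set[OF closed_nonneg_Reals_complex _ G lim]) auto
  next
    have "eventually (\<lambda>n. \<psi> n \<one> = 1) G"
      using ev1 by eventually_elim (simp add: \<psi>_def Tk(2) \<omega>_one)
    then have "((\<lambda>n. \<psi> n \<one>) \<longlongrightarrow> 1) G" by (rule tendsto_eventually)
    with lim show "l \<one> = 1" by (rule tendsto_unique[OF G])
  qed
  moreover have "l (T y) = l y" if y: "y \<in> carrier A" for y
  proof -
    \<comment> \<open>Shifting by \<open>T\<close> telescopes to two boundary terms. Each is at most
      \<open>6 * C * cnorm A y\<close>, whence the 12 below.\<close>
    have "\<psi> n (T y) - \<psi> n y = 1 / of_nat n * (\<omega> ((T ^^ n) y) - \<omega> y)" for n
    proof -
      have "(\<Sum>k<n. \<omega> ((T ^^ k) (T y))) - (\<Sum>k<n. \<omega> ((T ^^ k) y)) = (\<Sum>k<n. \<omega> ((T ^^ Suc k) y) - \<omega> ((T ^^ k) y))"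
        unfolding funpow_Suc_right by (simp add: sum_subtractf)
      also have "\<dots> = \<omega> ((T ^^ n) y) - \<omega> y"
        using sum_lessThan_telescope[of "\<lambda>k. \<omega> ((T ^^ k) y)" n] by simp
      finally show ?thesis
        using y positive_unital_mapD(1)[OF T y] by (simp add: \<psi>_def right_diff_distrib[symmetric] diff_divide_distrib[symmetric])
    qed
    moreover have "(\<lambda>n. 1 / of_nat n * (\<omega> ((T ^^ n) y) - \<omega> y)) \<longlonglongrightarrow> 0"
    proof (rule Lim_null_comparison[OF always_eventually[OF allI]])
      show "cmod (1 / of_nat n * (\<omega> ((T ^^ n) y) - \<omega> y)) \<le> 1 / real n * (12 * C * cnorm A y)" for n
        using norm_triangle_ineq4[of "\<omega> ((T ^^ n) y)" "\<omega> y"] \<omega>T[OF y, of n] \<omega>T[OF y, of 0]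
        by (simp add: Real_Vector_Spaces.norm_mult norm_divide divide_right_mono)
      show "(\<lambda>n. 1 / real n * (12 * C * cnorm A y)) \<longlonglongrightarrow> 0"
        by (intro tendsto_mult_left_zero lim_1_over_n)
    qed
    ultimately have "((\<lambda>n. \<psi> n (T y) - \<psi> n y) \<longlongrightarrow> 0) G"
      using tendsto_mono[OF G_seq] by simp
    from tendsto_unique[OF G this tendsto_diff[OF lim lim]] show ?thesis by simp
  qed
  ultimately have "l x = \<nu> x" using ue x by (simp add: uniquely_ergodic_def)
  then have "eventually (\<lambda>n. dist (\<psi> n x) (\<nu> x) < \<epsilon>) G"
    using tendstoD[OF lim[of x] \<epsilon>(1)] by simp
  with G_far have "eventually (\<lambda>_. False) G" by eventually_elim simp
  then show False using G by (simp add: trivial_limit_def)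
qed

text \<open>Every \<open>T^k\<close> fixes the unit, so removing \<open>c 1\<close> from
  \<open>x\<close> changes the term with index \<open>k\<close> by exactly \<open>b k * c\<close>
  times the unit.\<close>

lemma weighted_average_split:
  assumes T: "positive_unital_map T" and x [simp]: "x \<in> carrier A"
  shows "weighted_average A b T x n =
    weighted_average A b T (x \<ominus> c \<odot> \<one>) n \<oplus> (c * (1 / of_nat n * (\<Sum>k<n. b k))) \<odot> \<one>"
proof -
  note Tk = positive_unital_mapD[OF positive_unital_map_funpow[OF T]]
  have Tx: "(T ^^ k) x = (T ^^ k) (x \<ominus> c \<odot> \<one>) \<oplus> c \<odot> \<one>" for k
    by (simp add: Tk)
  have "(\<Oplus>\<^bsub>A\<^esub>k\<in>{..<n}. b k \<odot> (T ^^ k) x) =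
    (\<Oplus>\<^bsub>A\<^esub>k\<in>{..<n}. b k \<odot> (T ^^ k) (x \<ominus> c \<odot> \<one>)) \<oplus> (c * (\<Sum>k<n. b k)) \<odot> \<one>"
  proof (induction n)
    case (Suc n)
    have "(\<Oplus>\<^bsub>A\<^esub>k\<in>{..<Suc n}. b k \<odot> (T ^^ k) x) = b n \<odot> (T ^^ n) x \<oplus> (\<Oplus>\<^bsub>A\<^esub>k\<in>{..<n}. b k \<odot> (T ^^ k) x)"
      by (rule finsum_lessThan_Suc) (simp add: Tk)
    also have "b n \<odot> (T ^^ n) x = b n \<odot> (T ^^ n) (x \<ominus> c \<odot> \<one>) \<oplus> (c * b n) \<odot> \<one>"
      by (subst Tx) (simp add: Tk(1) scalar_right_distrib mult.commute)
    also have "\<dots> \<oplus> (\<Oplus>\<^bsub>A\<^esub>k\<in>{..<n}. b k \<odot> (T ^^ k) x) =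
        (b n \<odot> (T ^^ n) (x \<ominus> c \<odot> \<one>) \<oplus> (\<Oplus>\<^bsub>A\<^esub>k\<in>{..<n}. b k \<odot> (T ^^ k) (x \<ominus> c \<odot> \<one>)))
        \<oplus> (c * (\<Sum>k<Suc n. b k)) \<odot> \<one>"
      unfolding Suc.IH by (simp add: Tk(1) ring_distribs(1) scalar_left_distrib add_ac)
    also have "b n \<odot> (T ^^ n) (x \<ominus> c \<odot> \<one>) \<oplus> (\<Oplus>\<^bsub>A\<^esub>k\<in>{..<n}. b k \<odot> (T ^^ k) (x \<ominus> c \<odot> \<one>)) =
        (\<Oplus>\<^bsub>A\<^esub>k\<in>{..<Suc n}. b k \<odot> (T ^^ k) (x \<ominus> c \<odot> \<one>))"
      by (rule finsum_lessThan_Suc[symmetric]) (simp add: Tk)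
    finally show ?case .
  qed simp
  then show ?thesis by (simp add: weighted_average_def scalar_right_distrib Tk(1))
qed

end

section \<open>Means of Besicovitch sequences\<close>

text \<open>Evaluation at \<open>\<omega>\<close> turns the orbit values of a function at one point
  into values of a state, to which \<open>uniquely_ergodic_average\<close> applies.\<close>

lemma state_evaluation:
  assumes K: "compact_space K" and \<omega>: "\<omega> \<in> topspace K"
  shows "state (cont_algebra K) (\<lambda>f. f \<omega>)"
    and "f \<in> carrier (cont_algebra K) \<Longrightarrow> cmod (f \<omega>) \<le> cnorm (cont_algebra K) f"
proof -
  show "state (cont_algebra K) (\<lambda>f. f \<omega>)"
    using \<omega> by (auto simp: state_def linear_functional_def cont_algebra_def complex_nonneg_Reals_iff)
  assume f: "f \<in> carrier (cont_algebra K)"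
  have "compactin euclidean (f ` topspace K)"
    by (rule image_compactin[of K]) (use f K in \<open>auto simp: cont_algebra_def compact_space_def\<close>)
  then have "bounded (f ` topspace K)" by (simp add: compact_imp_bounded)
  then have "bdd_above (insert 0 ((\<lambda>\<omega>. cmod (f \<omega>)) ` topspace K))"
    by (auto simp: bounded_iff bdd_above_def intro: max.coboundedI1 max.coboundedI2)
  then show "cmod (f \<omega>) \<le> cnorm (cont_algebra K) f"
    using \<omega> by (auto simp: cont_algebra_def intro!: cSup_upper)
qed

text \<open>The approximating system, and with it the number \<open>\<nu> f\<^sub>0\<close>, changes
  with \<open>\<epsilon>\<close>, so no limit is at hand in advance. For each
  \<open>\<epsilon>\<close> the averages are eventually close to one number, which is enough for the
  Cauchy criterion.\<close>

lemma S_Besicovitch_average_convergent: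
  assumes "S_Besicovitch TYPE('k) b"
  shows "convergent (\<lambda>n. 1 / of_nat n * (\<Sum>k<n. b k))"
proof (rule Cauchy_convergent, rule metric_CauchyI)
  fix \<epsilon> :: real assume "0 < \<epsilon>"
  \<comment> \<open>One quarter pays for the approximation of \<open>b\<close> and one for the
    ergodic convergence; comparing two averages doubles both.\<close>
  then have "0 < \<epsilon> / 4" by simp
  then obtain K :: "'k topology" and \<nu> T\<^sub>1 f\<^sub>0 \<omega>\<^sub>0 where K: "compact_space K"
    and ue: "uniquely_ergodic (cont_algebra K) \<nu> T\<^sub>1"
    and f\<^sub>0: "f\<^sub>0 \<in> carrier (cont_algebra K)" and \<omega>\<^sub>0: "\<omega>\<^sub>0 \<in> topspace K"
    and limsup: "limsup (\<lambda>n. ereal (1 / real n * (\<Sum>k<n. cmod (b k - (T\<^sub>1 ^^ k) f\<^sub>0 \<omega>\<^sub>0)))) < ereal (\<epsilon> / 4)"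
    using assms unfolding S_Besicovitch_def by blast
  interpret CK: cstar_algebra "cont_algebra K" by (rule cstar_algebra_cont_algebra[OF K])
  define a where "a n = 1 / of_nat n * (\<Sum>k<n. (T\<^sub>1 ^^ k) f\<^sub>0 \<omega>\<^sub>0)" for n
  have "a \<longlonglongrightarrow> \<nu> f\<^sub>0"
    unfolding a_def using state_evaluation[OF K \<omega>\<^sub>0]
    by (intro CK.uniquely_ergodic_average[OF ue _ _ _ f\<^sub>0, of "\<lambda>f. f \<omega>\<^sub>0" 1]) auto
  then have "eventually (\<lambda>n. dist (a n) (\<nu> f\<^sub>0) < \<epsilon> / 4) sequentially"
    by (rule tendstoD[OF _ \<open>0 < \<epsilon> / 4\<close>])
  moreover have "eventually (\<lambda>n. 1 / real n * (\<Sum>k<n. cmod (b k - (T\<^sub>1 ^^ k) f\<^sub>0 \<omega>\<^sub>0)) < \<epsilon> / 4) sequentially"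
    using Limsup_lessD[OF limsup] by simp
  ultimately have "eventually (\<lambda>n. dist (1 / of_nat n * (\<Sum>k<n. b k)) (\<nu> f\<^sub>0) < \<epsilon> / 2) sequentially"
  proof eventually_elim
    case (elim n)
    have "1 / of_nat n * (\<Sum>k<n. b k) - a n = 1 / of_nat n * (\<Sum>k<n. b k - (T\<^sub>1 ^^ k) f\<^sub>0 \<omega>\<^sub>0)"
      by (simp add: a_def sum_subtractf diff_divide_distrib)
    then have "dist (1 / of_nat n * (\<Sum>k<n. b k)) (a n) = 1 / real n * cmod (\<Sum>k<n. b k - (T\<^sub>1 ^^ k) f\<^sub>0 \<omega>\<^sub>0)"
      by (simp add: dist_norm norm_mult norm_divide)
    also have "\<dots> \<le> 1 / real n * (\<Sum>k<n. cmod (b k - (T\<^sub>1 ^^ k) f\<^sub>0 \<omega>\<^sub>0))"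
      by (intro mult_left_mono norm_sum) simp
    finally show ?case
      using elim dist_triangle[of "1 / of_nat n * (\<Sum>k<n. b k)" "\<nu> f\<^sub>0" "a n"] by linarith
  qed
  then obtain N where N: "\<And>n. N \<le> n \<Longrightarrow> dist (1 / of_nat n * (\<Sum>k<n. b k)) (\<nu> f\<^sub>0) < \<epsilon> / 2"
    unfolding eventually_sequentially by blast
  show "\<exists>N. \<forall>m\<ge>N. \<forall>n\<ge>N. dist (1 / of_nat m * (\<Sum>k<m. b k)) (1 / of_nat n * (\<Sum>k<n. b k)) < \<epsilon>"
    using dist_triangle_half_l[OF N N] by blast
qed

theorem theorem5p1:
  fixes A :: "'a cstar" and \<phi> :: "'a \<Rightarrow> complex" and T :: "'a \<Rightarrow> 'a"
    and x :: 'a and b :: "nat \<Rightarrow> complex"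
  assumes "state_preserving_system A \<phi> T"
    and "strictly_weak_mixing A \<phi> T"
    and "x \<in> carrier A"
    and "S_Besicovitch TYPE('k) b"
  shows "\<exists>y\<in>carrier A. (\<lambda>n. cnorm A (weighted_average A b T x n \<ominus>\<^bsub>A\<^esub> y)) \<longlonglongrightarrow> 0"
proof -
  interpret cstar_algebra A
    using assms(1) by (simp add: state_preserving_system_def)
  note x [simp] = assms(3)
  have T: "positive_unital_map T"
    using assms(1) by (intro positive_unital_map_ucp) (simp add: state_preserving_system_def)
  note Tk = positive_unital_mapD[OF positive_unital_map_funpow[OF T]]
  define z where "z = x \<ominus>\<^bsub>A\<^esub> \<phi> x \<odot>\<^bsub>A\<^esub> \<one>\<^bsub>A\<^esub>"
  have z: "z \<in> carrier A" by (simp add: z_def)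
  have weak: "(\<lambda>n. 1 / real n * (\<Sum>k<n. cmod (\<psi> ((T ^^ k) z)))) \<longlonglongrightarrow> 0" if \<psi>: "in_dual A \<psi>" for \<psi>
  proof -
    have lin: "linear_functional A \<psi>" using \<psi> by (simp add: in_dual_def)
    \<comment> \<open>As \<open>T^k\<close> fixes the unit, this difference is exactly the one
      inside the absolute value in strict weak mixing.\<close>
    have "\<psi> ((T ^^ k) z) = \<psi> ((T ^^ k) x) - \<psi> \<one>\<^bsub>A\<^esub> * \<phi> x" for k
      by (simp add: z_def Tk linear_functionalD[OF lin])
    then show ?thesis using assms(2) \<psi> x by (simp add: strictly_weak_mixing_def)
  qed
  obtain M where M: "0 < M" "\<And>k. cmod (b k) \<le> M"
    using assms(4) unfolding S_Besicovitch_def bounded_pos by auto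
  have null: "(\<lambda>n. cnorm A (weighted_average A b T z n)) \<longlonglongrightarrow> 0"
    by (rule weighted_average_norm_null[OF T z weak M(2,1)])
  obtain \<beta> where \<beta>: "(\<lambda>n. 1 / of_nat n * (\<Sum>k<n. b k)) \<longlonglongrightarrow> \<beta>"
    using S_Besicovitch_average_convergent[OF assms(4)] by (auto simp: convergent_def)
  define a where "a n = 1 / of_nat n * (\<Sum>k<n. b k)" for n
  \<comment> \<open>The part coming from \<open>z\<close> vanishes in norm, so the scalar part alone
    determines the limit.\<close>
  define y where "y = (\<phi> x * \<beta>) \<odot>\<^bsub>A\<^esub> \<one>\<^bsub>A\<^esub>"
  have y: "y \<in> carrier A" by (simp add: y_def)
  have w: "weighted_average A b T z n \<in> carrier A" for n
    by (rule weighted_average_closed[OF Tk(1)[OF z]])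
  have "cnorm A (weighted_average A b T x n \<ominus>\<^bsub>A\<^esub> y) \<le>
      cnorm A (weighted_average A b T z n) + cmod (\<phi> x * (a n - \<beta>))" for n
  proof -
    have "weighted_average A b T x n = weighted_average A b T z n \<oplus>\<^bsub>A\<^esub> (\<phi> x * a n) \<odot>\<^bsub>A\<^esub> \<one>\<^bsub>A\<^esub>"
      unfolding z_def a_def by (rule weighted_average_split[OF T x])
    then have "weighted_average A b T x n \<ominus>\<^bsub>A\<^esub> y =
        weighted_average A b T z n \<oplus>\<^bsub>A\<^esub> (\<phi> x * (a n - \<beta>)) \<odot>\<^bsub>A\<^esub> \<one>\<^bsub>A\<^esub>"
      using w[of n] by (simp add: y_def diff_scalar add_assoc collect right_diff_distrib)
    also have "cnorm A \<dots> \<le> cnorm A (weighted_average A b T z n) + cmod (\<phi> x * (a n - \<beta>)) * cnorm A \<one>\<^bsub>A\<^esub>"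
      using norm_add[OF w[of n], of "(\<phi> x * (a n - \<beta>)) \<odot>\<^bsub>A\<^esub> \<one>\<^bsub>A\<^esub>"]
        norm_smult[of "\<one>\<^bsub>A\<^esub>"] by simp
    also have "\<dots> \<le> cnorm A (weighted_average A b T z n) + cmod (\<phi> x * (a n - \<beta>))"
      using cnorm_one_le by (simp add: mult_left_le)
    finally show ?thesis .
  qed
  moreover have "(\<lambda>n. cnorm A (weighted_average A b T z n) + cmod (\<phi> x * (a n - \<beta>))) \<longlonglongrightarrow> 0"
  proof -
    have "(\<lambda>n. \<phi> x * (a n - \<beta>)) \<longlonglongrightarrow> 0"
      using \<beta> unfolding a_def by (intro tendsto_mult_right_zero LIM_zero)
    then show ?thesis using tendsto_add[OF null tendsto_norm_zero] by simp
  qed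
  moreover have "weighted_average A b T x n \<in> carrier A" for n
    by (rule weighted_average_closed[OF Tk(1)[OF x]])
  ultimately have "norm_limit (weighted_average A b T x) y"
    using y by (intro norm_limitI)
  then show ?thesis using norm_limitD(2,3) by blast
qed

end
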